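(* There exist positive absolute constants $c, C$ such that the following holds. Let $n\in\mathbb{N}^*$ and $\beta>0$, and let $\sigma$ be drawn from $\mathbb{P}_{n,\beta}$. Then for any $s\in[n]$, $$c\,\min\{\max\{\beta^{-2},1\},n\}\;\le\;\mathbb{E}[|\mathcal{C}_s(\sigma)|]\;\le\; C\,\min\{\max\{\beta^{-2},1\},n\}.$$
   Context: $\mathbb{N}^*$ is the set of positive integers and $[n]=\{1,\dots,n\}$. $S_n$ is the symmetric group on $[n]$. For $\sigma,\tau\in S_n$, $H(\sigma,\tau)=\sum_{j=1}^n|\sigma(j)-\tau(j)|$, and $Id$ is the identity permutation. $\mathbb{P}_{n,\beta}$ (the Mallows model with the $L^1$ distance) is the probability measure on $S_n$ given by $\mathbb{P}_{n,\beta}(\sigma)=Z_{n,\beta}^{-1}\exp(-\beta H(\sigma,Id))$, where $Z_{n,\beta}$ is the normalizing constant. $\mathcal{C}_s(\sigma)$ is the set of points in the cycle of $\sigma$ that contains $s$. *)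

theory Defs
  imports "HOL-Probability.Probability" "HOL-Combinatorics.Combinatorics"
begin

text \<open>
  The symmetric group on \<open>{1..n}\<close> is the set of all \<open>\<sigma> :: nat \<Rightarrow> nat\<close> with
  \<open>\<sigma> permutes {1..n}\<close>, i.e. bijections that fix every point outside \<open>{1..n}\<close>.
\<close>

definition L1_dist :: "nat \<Rightarrow> (nat \<Rightarrow> nat) \<Rightarrow> (nat \<Rightarrow> nat) \<Rightarrow> real" where
  "L1_dist n \<sigma> \<tau> = (\<Sum>j\<in>{1..n}. \<bar>real (\<sigma> j) - real (\<tau> j)\<bar>)"

definition mallows_Z :: "nat \<Rightarrow> real \<Rightarrow> real" where
  "mallows_Z n \<beta> = (\<Sum>\<sigma> | \<sigma> permutes {1..n}. exp (- \<beta> * L1_dist n \<sigma> id))"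

definition mallows_pmf :: "nat \<Rightarrow> real \<Rightarrow> (nat \<Rightarrow> nat) pmf" where
  "mallows_pmf n \<beta> = embed_pmf (\<lambda>\<sigma>.
     if \<sigma> permutes {1..n} then exp (- \<beta> * L1_dist n \<sigma> id) / mallows_Z n \<beta> else 0)"

text \<open>
  The library's \<open>orbit \<sigma> s\<close> is \<open>{\<sigma> s, \<sigma> (\<sigma> s), \<dots>}\<close>, starting at the first iterate;
  for a permutation of a finite set it contains \<open>s\<close> itself.
\<close>

definition cycle_of :: "nat \<Rightarrow> (nat \<Rightarrow> nat) \<Rightarrow> nat set" where
  "cycle_of s \<sigma> = orbit \<sigma> s"

lemma mallows_Z_pos: "mallows_Z n \<beta> > 0"
  unfolding mallows_Z_def
proof (rule sum_pos)
  show "finite {\<sigma>. \<sigma> permutes {1..n}}" by (rule finite_permutations) simp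
  have "id permutes {1..n}" by (rule permutes_id)
  then show "{\<sigma>. \<sigma> permutes {1..n}} \<noteq> {}" by blast
qed simp

text \<open>The function embedded in \<open>mallows_pmf\<close> is a probability mass function.\<close>

lemma pmf_mallows:
  "pmf (mallows_pmf n \<beta>) \<sigma> =
     (if \<sigma> permutes {1..n} then exp (- \<beta> * L1_dist n \<sigma> id) / mallows_Z n \<beta> else 0)"
  unfolding mallows_pmf_def
proof (rule pmf_embed_pmf)
  let ?S = "{\<sigma>. \<sigma> permutes {1..n}}"
  let ?f = "\<lambda>\<sigma>. if \<sigma> permutes {1..n} then exp (- \<beta> * L1_dist n \<sigma> id) / mallows_Z n \<beta> else 0"
  have fin: "finite ?S" by (rule finite_permutations) simp
  show nn: "?f \<sigma> \<ge> 0" for \<sigma> using mallows_Z_pos[of n \<beta>] by simp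
  have "(\<integral>\<^sup>+\<sigma>. ennreal (?f \<sigma>) \<partial>count_space UNIV) = (\<Sum>\<sigma>\<in>?S. ennreal (?f \<sigma>))"
    by (rule nn_integral_count_space') (use fin in auto)
  also have "\<dots> = ennreal (\<Sum>\<sigma>\<in>?S. ?f \<sigma>)" by (rule sum_ennreal) (rule nn)
  also have "(\<Sum>\<sigma>\<in>?S. ?f \<sigma>) = (\<Sum>\<sigma>\<in>?S. exp (- \<beta> * L1_dist n \<sigma> id) / mallows_Z n \<beta>)"
    by (rule sum.cong) auto
  also have "\<dots> = mallows_Z n \<beta> / mallows_Z n \<beta>"
    by (simp only: mallows_Z_def sum_divide_distrib)
  also have "\<dots> = 1" using mallows_Z_pos[of n \<beta>] by simp
  finally show "(\<integral>\<^sup>+\<sigma>. ennreal (?f \<sigma>) \<partial>count_space UNIV) = 1" by simp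
qed

lemma set_pmf_mallows: "set_pmf (mallows_pmf n \<beta>) = {\<sigma>. \<sigma> permutes {1..n}}"
  using mallows_Z_pos[of n \<beta>] by (auto simp: set_pmf_eq pmf_mallows)

lemma self_in_cycle_of:
  assumes "\<sigma> permutes {1..n}"
  shows "s \<in> cycle_of s \<sigma>"
proof -
  have "permutation \<sigma>" using assms unfolding permutation_permutes by blast
  then show ?thesis unfolding cycle_of_def by (rule permutation_self_in_orbit)
qed

end

theory Submission
  imports Defs
begin

text \<open>
  Reveal \<open>\<sigma>\<close> from left to right: at time \<open>j\<close> only the arcs \<open>i \<mapsto> \<sigma> i\<close> with both ends in
  \<open>{1..j}\<close> are visible.  They form a partial injection, a disjoint union of cycles and of paths, and
  the number of paths is the number \<open>m\<close> of missing arcs.  Every missing arc at time \<open>k\<close> stands for one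
  arc of \<open>\<sigma>\<close> leaving \<open>{1..k}\<close> and one entering it, so the \<open>L1\<close> distance of \<open>\<sigma>\<close> to the identity is
  twice the sum over \<open>k\<close> of the numbers of paths.  With \<open>t = exp (- 2 * \<beta>)\<close> the Mallows weight is
  therefore a product of factors \<open>t\<close> to the number of paths, one for each time.  The next point can
  start a new path in one way, keep the number of paths in \<open>2 * m + 1\<close> ways (as a fixed point or at an
  end of an old path), or join the head of a path to the tail of a path in \<open>m\<^sup>2\<close> ways.  Hence the
  total weight of all completions depends only on \<open>m\<close> and on the number \<open>r\<close> of points still to come;
  it obeys the recursion \<open>completions\<close>.  While \<open>s\<close> lies on a path, exactly one of the \<open>m\<^sup>2\<close> joins closes
  its cycle.  For small \<open>\<beta>\<close> and away from the ends the typical value of \<open>m\<close> is of order \<open>1 / \<beta>\<close> (or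
  \<open>n\<close>, if that is smaller), which explains why cycles have length of order \<open>1 / \<beta>\<^sup>2\<close> (or \<open>n\<close>).

  Upper bound.  If \<open>v > s\<close> is in the cycle of \<open>s\<close>, then \<open>s\<close> lies on a path at time \<open>v - 1\<close>.  So the
  expected number of later points of the cycle is at most the sum over \<open>j\<close> of the probabilities that
  \<open>s\<close> is on a path at time \<open>j\<close>.  In each step this probability drops by at least a fixed multiple of
  \<open>min (\<beta>\<^sup>2) 1\<close> times itself (\<open>open_mass_le_drop\<close>), and the drops telescope.  For the drop one needs
  that too many paths are unlikely, also under the conditioning that \<open>s\<close> is still on one of them:
  adding a missing arc that does not close the cycle of \<open>s\<close> maps configurations with \<open>m + 1\<close> paths to those with \<open>m\<close>
  paths, and counting the preimages gives \<open>open_level_Suc_le\<close>; on the side of the future,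
  \<open>completions_Suc_le\<close> bounds the ratio of consecutive values by \<open>2 / (1 - t)\<close>.

  Lower bound.  The reverse estimate \<open>kappa_completions_le\<close> shows that the probability of closing the
  cycle of \<open>s\<close> in one step is at most of order \<open>max (\<beta>\<^sup>2) (1 / n\<^sup>2)\<close> away from the right end.  So
  for a small multiple \<open>L\<close> of \<open>min (1 / \<beta>\<^sup>2) n\<close> any two points of \<open>{s..s + L}\<close> are both on paths at time
  \<open>s + L\<close> with probability at least one half, provided that minimum is large.  If they are on two
  different paths, then at every step two joins merge these paths while two joins close one of them, all with the same weight; so the
  points end in the same cycle with conditional probability at least one half
  (\<open>extension_sum_link_potential\<close>).  Summing over the second point gives the bound for \<open>s\<close> in the left
  half, and the reflection \<open>i \<mapsto> n + 1 - i\<close> transfers both bounds to the other side of \<open>s\<close>.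
\<close>

section \<open>Partial injections and their extensions\<close>

text \<open>
  The visible part of a permutation is kept as a set of arcs, so that restriction is intersection and
  reachability along arcs is the transitive closure.
\<close>

definition partial_inj :: "nat \<Rightarrow> (nat \<times> nat) set set" where
  "partial_inj j = {p. p \<subseteq> {1..j} \<times> {1..j} \<and> single_valued p \<and> single_valued (p\<inverse>)}"

text \<open>
  The last points of the paths of \<open>p\<close>, those whose image is still unknown; \<open>tails\<close> are the first points.
\<close>

definition heads :: "nat \<Rightarrow> (nat \<times> nat) set \<Rightarrow> nat set" where
  "heads j p = {1..j} - Domain p"

definition tails :: "nat \<Rightarrow> (nat \<times> nat) set \<Rightarrow> nat set" where
  "tails j p = {1..j} - Range p"

definition restr :: "nat \<Rightarrow> (nat \<times> nat) set \<Rightarrow> (nat \<times> nat) set" where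
  "restr j p = p \<inter> {1..j} \<times> {1..j}"

lemma finite_partial_inj: "finite (partial_inj j)"
  by (rule finite_subset[of _ "Pow ({1..j} \<times> {1..j})"]) (auto simp: partial_inj_def)

lemma partial_inj_finite: "p \<in> partial_inj j \<Longrightarrow> finite p"
  by (rule finite_subset[of p "{1..j} \<times> {1..j}"]) (auto simp: partial_inj_def)

lemma converse_partial_inj: "p \<in> partial_inj j \<Longrightarrow> p\<inverse> \<in> partial_inj j"
  by (auto simp: partial_inj_def)

lemma heads_converse: "heads j (p\<inverse>) = tails j p"
  by (simp add: heads_def tails_def)

lemma card_heads:
  assumes "p \<in> partial_inj j"
  shows "card (heads j p) = j - card p" "card p \<le> j"
proof -
  have sub: "p \<subseteq> {1..j} \<times> {1..j}" and sv: "single_valued p"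
    using assms by (auto simp: partial_inj_def)
  have "inj_on fst p"
    using sv by (auto simp: inj_on_def single_valued_def)
  then have c: "card (Domain p) = card p"
    by (metis card_image fst_eq_Domain)
  have D: "Domain p \<subseteq> {1..j}" using sub by auto
  show "card (heads j p) = j - card p"
    unfolding heads_def using D c by (simp add: card_Diff_subset finite_subset[OF D])
  show "card p \<le> j" using card_mono[OF _ D] c by simp
qed

lemma card_tails:
  assumes "p \<in> partial_inj j"
  shows "card (tails j p) = j - card p"
  using card_heads(1)[OF converse_partial_inj[OF assms]] by (simp add: heads_converse)

lemma finite_heads [simp]: "finite (heads j p)" and finite_tails [simp]: "finite (tails j p)"
  by (auto simp: heads_def tails_def)

lemma heads_less: "a \<in> heads j p \<Longrightarrow> a \<le> j \<and> 1 \<le> a"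
  and tails_less: "a \<in> tails j p \<Longrightarrow> a \<le> j \<and> 1 \<le> a"
  by (auto simp: heads_def tails_def)

lemma restr_partial_inj: "p \<in> partial_inj k \<Longrightarrow> restr j p \<in> partial_inj j"
  by (auto simp: partial_inj_def restr_def single_valued_def)

lemma restr_id: "p \<in> partial_inj j \<Longrightarrow> restr j p = p"
  by (auto simp: partial_inj_def restr_def)

lemma restr_restr: "i \<le> j \<Longrightarrow> restr i (restr j p) = restr i p"
  by (auto simp: restr_def)

text \<open>
  The arcs at the new point \<open>Suc j\<close> are determined by its preimage and its image.  Each of them is a head
  (respectively tail) or lies in the future, and the loop is the only case in which the new point is
  its own preimage.
\<close>

lemma extensions:
  assumes p: "p \<in> partial_inj j"
  shows "{q \<in> partial_inj (Suc j). restr j q = p} =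
    insert p (insert (insert (Suc j, Suc j) p)
     ((\<lambda>a. insert (a, Suc j) p) ` heads j p \<union>
      ((\<lambda>b. insert (Suc j, b) p) ` tails j p \<union>
      (\<lambda>(a, b). insert (a, Suc j) (insert (Suc j, b) p)) ` (heads j p \<times> tails j p))))"
    (is "?L = ?R")
proof
  have sub: "p \<subseteq> {1..j} \<times> {1..j}" and sv: "single_valued p" and sv': "single_valued (p\<inverse>)"
    using p by (auto simp: partial_inj_def)
  have nc: "(x, Suc j) \<notin> p" "(Suc j, x) \<notin> p" for x using sub by auto
  have m0: "p \<in> ?L" using sub sv sv' by (auto simp: partial_inj_def restr_def)
  have m1: "insert (Suc j, Suc j) p \<in> ?L"
    using sub sv sv' nc by (auto simp: partial_inj_def restr_def single_valued_def)
  have m2: "insert (a, Suc j) p \<in> ?L" if "a \<in> heads j p" for a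
    using sub sv sv' nc that
    by (auto simp: partial_inj_def restr_def single_valued_def heads_def)
  have m3: "insert (Suc j, b) p \<in> ?L" if "b \<in> tails j p" for b
    using sub sv sv' nc that
    by (auto simp: partial_inj_def restr_def single_valued_def tails_def)
  have m4: "insert (a, Suc j) (insert (Suc j, b) p) \<in> ?L" if "a \<in> heads j p" "b \<in> tails j p" for a b
    using sub sv sv' nc that
    by (auto simp: partial_inj_def restr_def single_valued_def heads_def tails_def)
  show "?R \<subseteq> ?L"
  proof (intro insert_subsetI Un_least image_subsetI m0 m1 m2 m3)
    fix x assume "x \<in> heads j p \<times> tails j p"
    then show "(case x of (a, b) \<Rightarrow> insert (a, Suc j) (insert (Suc j, b) p)) \<in> ?L"
      using m4 by (cases x) simp
  qed
  show "?L \<subseteq> ?R"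
  proof
    fix q assume "q \<in> ?L"
    then have q: "q \<in> partial_inj (Suc j)" and r: "restr j q = p" by auto
    have qs: "q \<subseteq> {1..Suc j} \<times> {1..Suc j}" and sq: "single_valued q" and sq': "single_valued (q\<inverse>)"
      using q by (auto simp: partial_inj_def)
    define A where "A = {x. (x, Suc j) \<in> q}"
    define B where "B = {x. (Suc j, x) \<in> q}"
    have qe: "q = p \<union> (A \<times> {Suc j}) \<union> ({Suc j} \<times> B)"
    proof -
      have "x = Suc j \<or> y = Suc j \<or> (x, y) \<in> p" if "(x, y) \<in> q" for x y
      proof -
        have "x \<in> {1..Suc j}" "y \<in> {1..Suc j}" using that qs by auto
        then show ?thesis using that r by (auto simp: restr_def)
      qed
      then show ?thesis unfolding A_def B_def using r by (auto simp: restr_def)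
    qed
    have A1: "x = y" if "x \<in> A" "y \<in> A" for x y
      using that sq' by (auto simp: A_def single_valued_def)
    have B1: "x = y" if "x \<in> B" "y \<in> B" for x y
      using that sq by (auto simp: B_def single_valued_def)
    have AB: "Suc j \<in> A \<longleftrightarrow> Suc j \<in> B" by (auto simp: A_def B_def)
    have Ah: "x \<in> heads j p" if "x \<in> A" "x \<noteq> Suc j" for x
    proof -
      have xq: "(x, Suc j) \<in> q" using that by (simp add: A_def)
      have "x \<in> {1..Suc j}" using xq qs by auto
      moreover have "x \<notin> Domain p"
      proof
        assume "x \<in> Domain p"
        then obtain y where y: "(x, y) \<in> p" by auto
        then have "(x, y) \<in> q" using qe by auto
        then have "y = Suc j" using xq sq by (auto simp: single_valued_def)
        then show False using y sub by auto
      qed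
      ultimately show ?thesis using that by (auto simp: heads_def)
    qed
    have Bt: "x \<in> tails j p" if "x \<in> B" "x \<noteq> Suc j" for x
    proof -
      have xq: "(Suc j, x) \<in> q" using that by (simp add: B_def)
      have "x \<in> {1..Suc j}" using xq qs by auto
      moreover have "x \<notin> Range p"
      proof
        assume "x \<in> Range p"
        then obtain y where y: "(y, x) \<in> p" by auto
        then have "(y, x) \<in> q" using qe by auto
        then have "y = Suc j" using xq sq' by (auto simp: single_valued_def)
        then show False using y sub by auto
      qed
      ultimately show ?thesis using that by (auto simp: tails_def)
    qed
    have "A = {} \<or> (\<exists>a. A = {a})" using A1 by blast
    moreover have "B = {} \<or> (\<exists>b. B = {b})" using B1 by blast
    ultimately consider "A = {}" "B = {}" | a where "A = {a}" "B = {}" | b where "A = {}" "B = {b}"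
      | a b where "A = {a}" "B = {b}" by blast
    then show "q \<in> ?R"
    proof cases
      case 1 then show ?thesis using qe by auto
    next
      case (2 a)
      have a: "a \<in> heads j p" using Ah[of a] AB 2 by auto
      have "q = insert (a, Suc j) p" using qe 2 by auto
      then show ?thesis using a by blast
    next
      case (3 b)
      have b: "b \<in> tails j p" using Bt[of b] AB 3 by auto
      have "q = insert (Suc j, b) p" using qe 3 by auto
      then show ?thesis using b by blast
    next
      case (4 a b)
      show ?thesis
      proof (cases "a = Suc j")
        case True
        then have "b = Suc j" using AB 4 by auto
        then have "q = insert (Suc j, Suc j) p" using qe 4 True by auto
        then show ?thesis by blast
      next
        case False
        then have "b \<noteq> Suc j" using AB 4 by auto
        then have ab: "(a, b) \<in> heads j p \<times> tails j p" using False Ah[of a] Bt[of b] 4 by auto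
        have "q = (\<lambda>(a, b). insert (a, Suc j) (insert (Suc j, b) p)) (a, b)" using qe 4 by auto
        then show ?thesis using ab by blast
      qed
    qed
  qed
qed

lemma sum_extensions:
  fixes g :: "(nat \<times> nat) set \<Rightarrow> real"
  assumes p: "p \<in> partial_inj j"
  shows "(\<Sum>q | q \<in> partial_inj (Suc j) \<and> restr j q = p. g q) =
    g p + g (insert (Suc j, Suc j) p) + (\<Sum>a\<in>heads j p. g (insert (a, Suc j) p))
      + (\<Sum>b\<in>tails j p. g (insert (Suc j, b) p))
      + (\<Sum>(a, b)\<in>heads j p \<times> tails j p. g (insert (a, Suc j) (insert (Suc j, b) p)))"
proof -
  let ?c = "Suc j"
  let ?f = "\<lambda>(a, b). insert (a, Suc j) (insert (Suc j, b) p)"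
  have sub: "p \<subseteq> {1..j} \<times> {1..j}" using p by (auto simp: partial_inj_def)
  have nc: "(x, ?c) \<notin> p" "(?c, x) \<notin> p" for x using sub by auto
  have hc: "a \<noteq> ?c" if "a \<in> heads j p" for a using that by (auto simp: heads_def)
  have tc: "a \<noteq> ?c" if "a \<in> tails j p" for a using that by (auto simp: tails_def)
  let ?A = "(\<lambda>a. insert (a, ?c) p) ` heads j p"
  let ?B = "(\<lambda>b. insert (?c, b) p) ` tails j p"
  let ?D = "?f ` (heads j p \<times> tails j p)"
  \<comment> \<open>The preimage and the image of the new point tell the kinds of extension apart.\<close>
  define I where "I q = {x. (x, ?c) \<in> q}" for q :: "(nat \<times> nat) set"
  define O' where "O' q = {x. (?c, x) \<in> q}" for q :: "(nat \<times> nat) set"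
  have Ip: "I p = {}" "O' p = {}" using nc by (simp_all add: I_def O'_def)
  have IL: "I (insert (?c, ?c) p) = {?c}" using nc by (simp add: I_def)
  have IA: "I (insert (a, ?c) p) = {a}" "O' (insert (a, ?c) p) = {}" if "a \<in> heads j p" for a
    using nc hc[OF that] by (simp_all add: I_def O'_def)
  have IB: "I (insert (?c, a) p) = {}" "O' (insert (?c, a) p) = {a}" if "a \<in> tails j p" for a
    using nc tc[OF that] by (simp_all add: I_def O'_def)
  have ID: "I (?f x) = {fst x}" "O' (?f x) = {snd x}" if "x \<in> heads j p \<times> tails j p" for x
    using nc hc[of "fst x"] tc[of "snd x"] that by (auto simp: I_def O'_def)
  have i1: "inj_on (\<lambda>a. insert (a, ?c) p) (heads j p)"
    by (rule inj_onI) (metis IA(1) singleton_inject)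
  have i2: "inj_on (\<lambda>a. insert (?c, a) p) (tails j p)"
    by (rule inj_onI) (metis IB(2) singleton_inject)
  have i3: "inj_on ?f (heads j p \<times> tails j p)"
  proof (rule inj_onI)
    fix x y assume h: "x \<in> heads j p \<times> tails j p" "y \<in> heads j p \<times> tails j p" "?f x = ?f y"
    have "{fst x} = {fst y}" unfolding ID(1)[OF h(1), symmetric] ID(1)[OF h(2), symmetric] h(3) ..
    moreover have "{snd x} = {snd y}"
      unfolding ID(2)[OF h(1), symmetric] ID(2)[OF h(2), symmetric] h(3) ..
    ultimately show "x = y" by (simp add: prod_eq_iff)
  qed
  have sA: "\<exists>a. a \<noteq> ?c \<and> I q = {a} \<and> O' q = {}" if "q \<in> ?A" for q using that IA hc by blast
  have sB: "\<exists>a. a \<noteq> ?c \<and> I q = {} \<and> O' q = {a}" if "q \<in> ?B" for q using that IB tc by blast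
  have sD: "\<exists>a b. a \<noteq> ?c \<and> I q = {a} \<and> O' q = {b}" if qD: "q \<in> ?D" for q
  proof -
    obtain x where x: "q = ?f x" "x \<in> heads j p \<times> tails j p" using qD by (rule imageE)
    have "fst x \<noteq> ?c" using x(2) hc by auto
    then show ?thesis using ID[OF x(2)] unfolding x(1) by blast
  qed
  have d1: "?B \<inter> ?D = {}"
    by (rule equals0I, elim IntE) (drule sB, drule sD, fastforce)
  have d2: "?A \<inter> (?B \<union> ?D) = {}"
    by (rule equals0I, elim IntE UnE) (drule sA, (drule sB | drule sD), fastforce)+
  have d3: "insert (?c, ?c) p \<notin> ?A \<union> (?B \<union> ?D)"
    by (rule notI, elim UnE) ((drule sA | drule sB | drule sD), insert IL, fastforce)+
  have d4: "p \<notin> insert (insert (?c, ?c) p) (?A \<union> (?B \<union> ?D))"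
  proof
    assume "p \<in> insert (insert (?c, ?c) p) (?A \<union> (?B \<union> ?D))"
    then consider "p = insert (?c, ?c) p" | "p \<in> ?A" | "p \<in> ?B" | "p \<in> ?D"
      by (elim insertE UnE) blast+
    then show False
    proof cases
      case 1 then show ?thesis using IL Ip by simp
    next
      case 2 then show ?thesis using sA Ip by fastforce
    next
      case 3 then show ?thesis using sB Ip by fastforce
    next
      case 4 then show ?thesis using sD Ip by fastforce
    qed
  qed
  have f: "finite ?A" "finite ?B" "finite ?D" by auto
  have "(\<Sum>q | q \<in> partial_inj (Suc j) \<and> restr j q = p. g q) =
    g p + (g (insert (?c, ?c) p) + (sum g ?A + (sum g ?B + sum g ?D)))"
    unfolding extensions[OF p]
    by (simp only: sum.insert[OF _ d4] sum.insert[OF _ d3] sum.union_disjoint[OF _ _ d2]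
        sum.union_disjoint[OF _ _ d1] f finite_insert finite_Un simp_thms)
  also have "sum g ?A = (\<Sum>a\<in>heads j p. g (insert (a, ?c) p))"
    by (simp add: sum.reindex[OF i1])
  also have "sum g ?B = (\<Sum>a\<in>tails j p. g (insert (?c, a) p))"
    by (simp add: sum.reindex[OF i2])
  also have "sum g ?D = (\<Sum>(a, b)\<in>heads j p \<times> tails j p. g (insert (a, ?c) (insert (?c, b) p)))"
    by (subst sum.reindex[OF i3]) (auto intro!: sum.cong)
  finally show ?thesis by simp
qed

section \<open>Paths and cycles\<close>

text \<open>
  Two points reachable from \<open>s\<close> are comparable because \<open>p\<close> is single valued, and nothing is reachable
  from a head except itself.
\<close>

lemma head_unique:
  assumes "p \<in> partial_inj j" "(s, a) \<in> p\<^sup>*" "(s, a') \<in> p\<^sup>*" "a \<in> heads j p" "a' \<in> heads j p"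
  shows "a = a'"
proof -
  have sv: "single_valued p" using assms by (auto simp: partial_inj_def)
  have "(a, a') \<in> p\<^sup>* \<or> (a', a) \<in> p\<^sup>*"
    using single_valued_confluent[OF sv assms(2,3)] .
  then show ?thesis
    using assms(4,5) by (metis DiffE Domain.DomainI converse_rtranclE heads_def)
qed

lemma tail_unique:
  assumes "p \<in> partial_inj j" "(a, s) \<in> p\<^sup>*" "(a', s) \<in> p\<^sup>*" "a \<in> tails j p" "a' \<in> tails j p"
  shows "a = a'"
  using head_unique[OF converse_partial_inj[OF assms(1)], of s a a'] assms
  by (simp add: rtrancl_converse heads_converse)

text \<open>
  If no head were reachable, \<open>p\<close> would map the finite set of points reachable from \<open>s\<close> injectively into
  itself, hence onto it, and \<open>s\<close> would be an image of one of them.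
\<close>

lemma head_exists:
  assumes p: "p \<in> partial_inj j" and s: "s \<in> {1..j}" and op: "(s, s) \<notin> p\<^sup>+"
  shows "\<exists>a\<in>heads j p. (s, a) \<in> p\<^sup>*"
proof (rule ccontr)
  assume no: "\<not> ?thesis"
  have sub: "p \<subseteq> {1..j} \<times> {1..j}" and sv: "single_valued p" and sv': "single_valued (p\<inverse>)"
    using p by (auto simp: partial_inj_def)
  let ?R = "p\<^sup>* `` {s}"
  have Rs: "?R \<subseteq> {1..j}"
  proof
    fix x assume "x \<in> ?R"
    then have "(s, x) \<in> p\<^sup>*" by simp
    then show "x \<in> {1..j}" using s sub by (cases rule: rtrancl.cases) auto
  qed
  have "\<exists>y. (x, y) \<in> p" if "x \<in> ?R" for x
    using that no Rs by (auto simp: heads_def)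
  then obtain f where f: "(x, f x) \<in> p" if "x \<in> ?R" for x by metis
  have "f ` ?R \<subseteq> ?R" using f by (auto intro: rtrancl_into_rtrancl)
  moreover have "inj_on f ?R"
    by (rule inj_onI) (metis f sv' single_valuedD converseI)
  moreover have "finite ?R" using Rs finite_subset by blast
  ultimately have "f ` ?R = ?R" by (simp add: endo_inj_surj)
  then obtain x where "x \<in> ?R" "f x = s" by (metis Image_singleton_iff image_iff rtrancl.rtrancl_refl)
  then have "(s, s) \<in> p\<^sup>+" using f[of x] by (auto intro: rtrancl_into_trancl1)
  then show False using op by simp
qed

lemma tail_exists:
  assumes p: "p \<in> partial_inj j" and s: "s \<in> {1..j}" and op: "(s, s) \<notin> p\<^sup>+"
  shows "\<exists>a\<in>tails j p. (a, s) \<in> p\<^sup>*"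
  using head_exists[OF converse_partial_inj[OF p] s] op
  by (simp add: trancl_converse rtrancl_converse heads_converse)

text \<open>
  The new point can only complete a cycle through an old point \<open>s\<close> if it is both entered and left,
  and then precisely when it joins the head of the path of \<open>s\<close> to the tail of the same path.
\<close>

lemma cycle_in_extension:
  assumes p: "p \<in> partial_inj j" and s: "s \<le> j"
  shows "(s, s) \<in> (insert (Suc j, Suc j) p)\<^sup>+ \<longleftrightarrow> (s, s) \<in> p\<^sup>+"
    "(s, s) \<in> (insert (a, Suc j) p)\<^sup>+ \<longleftrightarrow> (s, s) \<in> p\<^sup>+"
    "(s, s) \<in> (insert (Suc j, b) p)\<^sup>+ \<longleftrightarrow> (s, s) \<in> p\<^sup>+"
    "a \<le> j \<Longrightarrow> (s, s) \<in> (insert (a, Suc j) (insert (Suc j, b) p))\<^sup>+ \<longleftrightarrow>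
       (s, s) \<in> p\<^sup>+ \<or> (s, a) \<in> p\<^sup>* \<and> (b, s) \<in> p\<^sup>*"
proof -
  have sub: "p \<subseteq> {1..j} \<times> {1..j}" using p by (auto simp: partial_inj_def)
  have n1: "(x, Suc j) \<notin> p\<^sup>*" if "x \<le> j" for x
    by (rule notI, erule rtranclE) (use that sub in auto)
  have n2: "(Suc j, x) \<notin> p\<^sup>*" if "x \<le> j" for x
    by (rule notI, erule converse_rtranclE) (use that sub in auto)
  show "(s, s) \<in> (insert (Suc j, Suc j) p)\<^sup>+ \<longleftrightarrow> (s, s) \<in> p\<^sup>+"
    "(s, s) \<in> (insert (a, Suc j) p)\<^sup>+ \<longleftrightarrow> (s, s) \<in> p\<^sup>+"
    "(s, s) \<in> (insert (Suc j, b) p)\<^sup>+ \<longleftrightarrow> (s, s) \<in> p\<^sup>+"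
    using n1 n2 s by (auto simp: trancl_insert)
  show "(s, s) \<in> (insert (a, Suc j) (insert (Suc j, b) p))\<^sup>+ \<longleftrightarrow>
       (s, s) \<in> p\<^sup>+ \<or> (s, a) \<in> p\<^sup>* \<and> (b, s) \<in> p\<^sup>*" if "a \<le> j"
    using n1 n2 s that by (auto simp: trancl_insert rtrancl_insert)
qed

lemma new_point_cycle:
  assumes p: "p \<in> partial_inj j" 
  shows "(Suc j, Suc j) \<notin> p\<^sup>+"
    "a \<le> j \<Longrightarrow> (Suc j, Suc j) \<notin> (insert (a, Suc j) p)\<^sup>+"
    "b \<le> j \<Longrightarrow> (Suc j, Suc j) \<notin> (insert (Suc j, b) p)\<^sup>+"
    "a \<le> j \<Longrightarrow> b \<le> j \<Longrightarrow> (Suc j, Suc j) \<in> (insert (a, Suc j) (insert (Suc j, b) p))\<^sup>+ \<longleftrightarrow> (b, a) \<in> p\<^sup>*"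
proof -
  have sub: "p \<subseteq> {1..j} \<times> {1..j}" using p by (auto simp: partial_inj_def)
  have n1: "(x, Suc j) \<notin> p\<^sup>*" if "x \<le> j" for x
    by (rule notI, erule rtranclE) (use that sub in auto)
  have n2: "(Suc j, x) \<notin> p\<^sup>*" if "x \<le> j" for x
    by (rule notI, erule converse_rtranclE) (use that sub in auto)
  show n0: "(Suc j, Suc j) \<notin> p\<^sup>+"
    by (rule notI, erule tranclE) (use sub in auto)
  show "(Suc j, Suc j) \<notin> (insert (a, Suc j) p)\<^sup>+" if "a \<le> j"
    using n0 n1 n2 that by (auto simp: trancl_insert)
  show "(Suc j, Suc j) \<notin> (insert (Suc j, b) p)\<^sup>+" if "b \<le> j"
    using n0 n1 n2 that by (auto simp: trancl_insert)
  show "(Suc j, Suc j) \<in> (insert (a, Suc j) (insert (Suc j, b) p))\<^sup>+ \<longleftrightarrow> (b, a) \<in> p\<^sup>*" if "a \<le> j" "b \<le> j"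
    using n0 n1 n2 that by (auto simp: trancl_insert rtrancl_insert)
qed

section \<open>The weight of all completions\<close>

text \<open>
  The total weight of the completions of a configuration with \<open>m\<close> paths when \<open>r\<close> points are still to come.
  The three terms correspond to one more, the same number, and one less path after the next
  point.  For \<open>m = 0\<close> the truncated \<open>m - 1\<close> is harmless because its coefficient vanishes.
\<close>

fun completions :: "real \<Rightarrow> nat \<Rightarrow> nat \<Rightarrow> real" where
  "completions t 0 m = of_bool (m = 0)"
| "completions t (Suc r) m =
     t ^ (m + 1) * completions t r (m + 1) + (2 * real m + 1) * (t ^ m * completions t r m)
       + (real m)\<^sup>2 * (t ^ (m - 1) * completions t r (m - 1))"

lemma completions_nonneg: "0 \<le> t \<Longrightarrow> 0 \<le> completions t r m"
  by (induction r arbitrary: m) auto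

text \<open>
  The constant \<open>A = 2 / (1 - t)\<close> reproduces itself in the induction because \<open>t * A + 2 = A\<close>: the
  coefficients \<open>2 * m + 3\<close> and \<open>(m + 1)\<^sup>2\<close> of the recursion at \<open>m + 1\<close> exceed those at \<open>m\<close> by \<open>2\<close>
  and \<open>2 * m + 1\<close>, and these excesses are paid for by the factor \<open>t\<close> gained from the higher level.
\<close>

lemma completions_Suc_le:
  assumes t: "0 < t" "t < 1"
  shows "completions t r (Suc m) \<le> 2 / (1 - t) * completions t r m"
proof (induction r arbitrary: m)
  case 0
  then show ?case using t by simp
next
  case (Suc r)
  define A where "A = 2 / (1 - t)"
  have A: "0 \<le> A" "t * A + 2 = A" using t by (auto simp: A_def field_simps)
  let ?Y = "completions t r"
  have nn: "0 \<le> ?Y k" for k using completions_nonneg t by simp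
  have IH: "?Y (Suc k) \<le> A * ?Y k" for k using Suc unfolding A_def .
  define T where "T = t ^ m"
  have T: "0 \<le> T" using t by (simp add: T_def)
  have last: "(real m)\<^sup>2 * (t ^ m * ?Y m) \<le> (real m)\<^sup>2 * (t * A * (t ^ (m - 1) * ?Y (m - 1)))"
  proof (cases m)
    case (Suc k)
    have "t ^ m * ?Y m \<le> t ^ m * (A * ?Y k)"
      using IH[of k] t Suc by (intro mult_left_mono) auto
    also have "\<dots> = t * A * (t ^ (m - 1) * ?Y (m - 1))" using Suc by simp
    finally show ?thesis by (rule mult_left_mono) simp
  qed simp
  have "completions t (Suc r) (Suc m) =
     t * t * T * ?Y (Suc (Suc m)) + (2 * real m + 3) * (t * T * ?Y (Suc m)) + (real m + 1)\<^sup>2 * (T * ?Y m)"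
    by (simp add: T_def algebra_simps)
  also have "\<dots> \<le> t * t * T * (A * ?Y (Suc m)) + (2 * real m + 3) * (t * T * ?Y (Suc m)) + (real m + 1)\<^sup>2 * (T * ?Y m)"
    using IH[of "Suc m"] t T by (intro add_mono mult_left_mono) auto
  also have "\<dots> = A * (t * T * ?Y (Suc m)) + (2 * real m + 1) * (t * T * ?Y (Suc m)) + (real m + 1)\<^sup>2 * (T * ?Y m)"
  proof -
    have "A * (t * T * ?Y (Suc m)) = (t * A + 2) * (t * T * ?Y (Suc m))" by (simp only: A)
    then show ?thesis by (simp add: algebra_simps)
  qed
  also have "\<dots> \<le> A * (t * T * ?Y (Suc m)) + (2 * real m + 1) * (t * T * (A * ?Y m)) + (real m + 1)\<^sup>2 * (T * ?Y m)"
    using IH[of "m"] t T A by (intro add_mono mult_left_mono) auto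
  also have "\<dots> = A * (t * T * ?Y (Suc m)) + (2 * real m + 1) * ((t * A + 1) * (T * ?Y m)) + (real m)\<^sup>2 * (t ^ m * ?Y m)"
    by (simp add: T_def algebra_simps power2_eq_square)
  also have "\<dots> \<le> A * (t * T * ?Y (Suc m)) + (2 * real m + 1) * (A * (T * ?Y m)) + (real m)\<^sup>2 * (t * A * (t ^ (m - 1) * ?Y (m - 1)))"
  proof -
    have "(2 * real m + 1) * ((t * A + 1) * (T * ?Y m)) \<le> (2 * real m + 1) * (A * (T * ?Y m))"
      using A nn T t by (intro mult_left_mono mult_right_mono) auto
    then show ?thesis using last by linarith
  qed
  also have "\<dots> \<le> A * (t * T * ?Y (Suc m)) + (2 * real m + 1) * (A * (T * ?Y m)) + (real m)\<^sup>2 * (A * (t ^ (m - 1) * ?Y (m - 1)))"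
    using A nn t by (intro add_mono mult_left_mono mult_right_mono) auto
  also have "\<dots> = A * completions t (Suc r) m"
    by (simp add: T_def algebra_simps)
  finally show ?case by (simp only: A_def)
qed

text \<open>
  It measures how many paths the next \<open>r\<close> points can absorb.  For \<open>t\<close> bounded away from zero it is of
  the order of the smaller of \<open>r\<close> and \<open>1 / (1 - t)\<close>.
\<close>

definition kappa :: "real \<Rightarrow> nat \<Rightarrow> real" where
  "kappa t r = (\<Sum>i=1..r. t ^ i)"

lemma kappa_Suc: "kappa t (Suc r) = t * (kappa t r + 1)"
proof -
  have "kappa t (Suc r) = (\<Sum>i=0..r. t ^ Suc i)"
    unfolding kappa_def by (simp only: One_nat_def sum.shift_bounds_cl_Suc_ivl)
  also have "\<dots> = t + (\<Sum>i=1..r. t ^ Suc i)" by (simp add: sum.atLeast_Suc_atMost)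
  finally show ?thesis by (simp add: kappa_def sum_distrib_left algebra_simps)
qed

lemma kappa_nonneg: "0 \<le> t \<Longrightarrow> 0 \<le> kappa t r"
  by (simp add: kappa_def sum_nonneg)

lemma kappa_mono: "0 \<le> t \<Longrightarrow> r \<le> r' \<Longrightarrow> kappa t r \<le> kappa t r'"
  unfolding kappa_def by (rule sum_mono2) auto

text \<open>
  For \<open>t = 1\<close> this is an equality with \<open>kappa t r = r\<close>.  In general the relation at \<open>r\<close> with constant \<open>K\<close>
  implies the one at \<open>Suc r\<close> with constant \<open>t * (K + 1)\<close>, which is the recursion of \<open>kappa\<close>.  The summand
  \<open>m * completions t r m\<close> is there because no multiple of \<open>completions t r m\<close> can be a lower bound at
  \<open>m = r\<close>: with \<open>r\<close> points to come, more than \<open>r\<close> paths cannot be completed.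
\<close>

lemma kappa_completions_le:
  assumes t: "0 \<le> t" "t \<le> 1"
  shows "kappa t r * completions t r m \<le> completions t r (Suc m) + real m * completions t r m"
proof (induction r arbitrary: m)
  case 0
  then show ?case by (simp add: kappa_def)
next
  case (Suc r)
  define K where "K = kappa t r"
  have K: "0 \<le> K" using t by (simp add: K_def kappa_nonneg)
  let ?Y = "completions t r"
  have nn: "0 \<le> ?Y k" for k using completions_nonneg t by simp
  have IH: "K * ?Y k \<le> ?Y (Suc k) + real k * ?Y k" for k using Suc unfolding K_def .
  define T where "T = t ^ m"
  have T: "0 \<le> T" using t by (simp add: T_def)
  define b where "b = ?Y m"
  define a where "a = ?Y (Suc m)"
  define d where "d = ?Y (Suc (Suc m))"
  define U where "U = (real m)\<^sup>2 * (t ^ (m - 1) * ?Y (m - 1))"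
  have U: "0 \<le> U" using nn t by (simp add: U_def)
  have nn': "0 \<le> a" "0 \<le> b" using nn by (simp_all add: a_def b_def)
  have h1: "(K - real m - 1) * a \<le> d" using IH[of "Suc m"] by (simp add: a_def d_def algebra_simps)
  have h2: "(K - real m) * b \<le> a" using IH[of m] by (simp add: a_def b_def algebra_simps)
  have last: "t * (K - real m + 1) * U \<le> (real m)\<^sup>2 * (T * b)"
  proof (cases m)
    case (Suc k)
    have "(K - real k) * ?Y k \<le> b" using IH[of k] Suc by (simp add: b_def algebra_simps)
    then have "(real m)\<^sup>2 * (T * ((K - real k) * ?Y k)) \<le> (real m)\<^sup>2 * (T * b)"
      using T by (intro mult_left_mono) auto
    then show ?thesis using Suc by (simp add: U_def T_def algebra_simps)
  qed (simp add: U_def)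
  have e: "completions t (Suc r) (Suc m) + real m * completions t (Suc r) m =
    t * t * T * d + (2 * real m + 3) * (t * T * a) + (real m + 1)\<^sup>2 * (T * b)
     + real m * (t * T * a + (2 * real m + 1) * (T * b) + U)"
    by (simp add: T_def a_def b_def d_def U_def algebra_simps)
  have e2: "kappa t (Suc r) * completions t (Suc r) m = t * (K + 1) * (t * T * a + (2 * real m + 1) * (T * b) + U)"
    by (simp add: kappa_Suc K_def T_def a_def b_def U_def algebra_simps)
  have g1: "t * t * T * ((K - real m - 1) * a) \<le> t * t * T * d"
    using h1 t T by (intro mult_left_mono) auto
  have g2: "(2 * real m + 1) * (t * T * ((K - real m) * b)) \<le> (2 * real m + 1) * (t * T * a)"
    using h2 t T by (intro mult_left_mono) auto
  \<comment> \<open>The slack left in the three coefficients; it vanishes for \<open>t = 1\<close>.\<close>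
  have p1: "0 \<le> (1 - t) * (real m + 2) * (t * T * a)" using t T nn' by auto
  have p2: "0 \<le> (1 - t) * (real m + 1) * ((2 * real m + 1) * (T * b))" using t T nn' by auto
  have p3: "0 \<le> (1 - t) * real m * U" using t U by auto
  have "t * (K + 1) * (t * T * a + (2 * real m + 1) * (T * b) + U) + (1 - t) * (real m + 2) * (t * T * a)
     + (1 - t) * (real m + 1) * ((2 * real m + 1) * (T * b)) + (1 - t) * real m * U
    = t * t * T * ((K - real m - 1) * a) + (2 * real m + 1) * (t * T * ((K - real m) * b))
      + t * (K - real m + 1) * U + 2 * (t * T * a) + (2 * real m + 1) * (T * b)
      + real m * (t * T * a + (2 * real m + 1) * (T * b) + U)"
    by (simp add: algebra_simps power2_eq_square)
  also have "\<dots> \<le> t * t * T * d + (2 * real m + 1) * (t * T * a) + (real m)\<^sup>2 * (T * b) 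
       + 2 * (t * T * a) + (2 * real m + 1) * (T * b)
      + real m * (t * T * a + (2 * real m + 1) * (T * b) + U)"
    using g1 g2 last by linarith
  also have "\<dots> = completions t (Suc r) (Suc m) + real m * completions t (Suc r) m"
    unfolding e by (simp add: algebra_simps power2_eq_square)
  finally show ?case unfolding e2 using p1 p2 p3 by linarith
qed

text \<open>
  Conditionally on \<open>m\<close> paths, a given join has probability at least the inverse of the square on the right.
\<close>

lemma completions_le_close:
  assumes t: "0 < t" "t < 1" and m: "m \<ge> 1"
  shows "completions t (Suc r) m \<le> (2 * t / (1 - t) + real m + 1)\<^sup>2 * (t ^ (m - 1) * completions t r (m - 1))"
proof -
  obtain k where k: "m = Suc k" using m by (cases m) auto
  define A where "A = 2 / (1 - t)"
  have A: "0 \<le> A" using t by (simp add: A_def)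
  let ?Y = "completions t r"
  have nn: "0 \<le> ?Y k" for k using completions_nonneg t by simp
  have IH: "?Y (Suc k) \<le> A * ?Y k" for k using completions_Suc_le[OF t] unfolding A_def .
  have I2: "?Y (Suc (Suc k)) \<le> A * (A * ?Y k)"
    using IH[of "Suc k"] IH[of k] A by (meson mult_left_mono order_trans)
  have "completions t (Suc r) m = t * t * (t ^ k * ?Y (Suc (Suc k))) + (2 * real m + 1) * (t * (t ^ k * ?Y (Suc k)))
      + (real m)\<^sup>2 * (t ^ k * ?Y k)"
    by (simp add: k algebra_simps)
  also have "\<dots> \<le> t * t * (t ^ k * (A * (A * ?Y k))) + (2 * real m + 1) * (t * (t ^ k * (A * ?Y k)))
      + (real m)\<^sup>2 * (t ^ k * ?Y k)"
    using IH[of k] I2 t by (intro add_mono mult_left_mono) auto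
  also have "\<dots> = ((t * A)\<^sup>2 + (2 * real m + 1) * (t * A) + (real m)\<^sup>2) * (t ^ k * ?Y k)"
    by (simp add: algebra_simps power2_eq_square)
  also have "\<dots> \<le> (t * A + real m + 1)\<^sup>2 * (t ^ k * ?Y k)"
    using A nn t by (intro mult_right_mono) (auto simp: algebra_simps power2_eq_square)
  finally show ?thesis by (simp add: k A_def algebra_simps)
qed

text \<open>
  The terms of the recursion dominate \<open>Y (m + 1) + 2 * m * Y m + m\<^sup>2 * Y (m - 1)\<close>, which splits
  into \<open>(Y (m + 1) + m * Y m) + m * (Y m + m * Y (m - 1))\<close>; here \<open>Y\<close> abbreviates \<open>completions t r\<close>.
  The estimate \<open>kappa_completions_le\<close> applies to both parts.
\<close>

lemma completions_ge_open:
  assumes t: "0 \<le> t" "t \<le> 1"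
  shows "t ^ (m + 1) * (kappa t r * (completions t r m + real m * completions t r (m - 1)))
     \<le> completions t (Suc r) m"
proof -
  let ?Y = "completions t r"
  have nn: "0 \<le> ?Y k" for k using completions_nonneg t by simp
  have "kappa t r * (real m * ?Y (m - 1)) \<le> real m * (?Y m + real m * ?Y (m - 1))"
  proof (cases m)
    case (Suc k)
    have "kappa t r * ?Y k \<le> ?Y m + real k * ?Y k"
      using kappa_completions_le[OF t, of r k] Suc by simp
    also have "\<dots> \<le> ?Y m + real m * ?Y k"
      using nn Suc by (intro add_left_mono mult_right_mono) auto
    finally have "real m * (kappa t r * ?Y k) \<le> real m * (?Y m + real m * ?Y k)"
      by (rule mult_left_mono) simp
    then show ?thesis using Suc by (simp add: mult.left_commute)
  qed simp
  with kappa_completions_le[OF t, of r m]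
  have "kappa t r * (?Y m + real m * ?Y (m - 1)) \<le> ?Y (Suc m) + 2 * real m * ?Y m + (real m)\<^sup>2 * ?Y (m - 1)"
    by (simp add: algebra_simps power2_eq_square)
  also have "\<dots> \<le> ?Y (Suc m) + (2 * real m + 1) * ?Y m + (real m)\<^sup>2 * ?Y (m - 1)"
    using nn[of m] by (simp add: algebra_simps)
  finally have "t ^ (m + 1) * (kappa t r * (?Y m + real m * ?Y (m - 1)))
     \<le> t ^ (m + 1) * (?Y (Suc m) + (2 * real m + 1) * ?Y m + (real m)\<^sup>2 * ?Y (m - 1))"
    using t by (intro mult_left_mono) auto
  also have "\<dots> = t ^ (m + 1) * ?Y (Suc m) + (2 * real m + 1) * (t ^ (m + 1) * ?Y m) + (real m)\<^sup>2 * (t ^ (m + 1) * ?Y (m - 1))"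
    by (simp add: algebra_simps)
  also have "\<dots> \<le> completions t (Suc r) m"
  proof -
    have "t ^ (m + 1) \<le> t ^ m" "t ^ (m + 1) \<le> t ^ (m - 1)"
      using t by (intro power_decreasing; simp)+
    then show ?thesis unfolding completions.simps using nn t
      by (intro add_mono mult_left_mono mult_right_mono) auto
  qed
  finally show ?thesis .
qed

text \<open>
  The left hand side is the weight \<open>t ^ (m - 1) * completions t r (m - 1)\<close> of one join times
  \<open>(t * kappa t r)\<^sup>2\<close>.  So a given join has conditional probability at most the inverse of this square.
\<close>

lemma completions_ge_close:
  assumes t: "0 \<le> t" "t \<le> 1" and m: "m \<ge> 1"
  shows "t ^ (m + 1) * ((kappa t r)\<^sup>2 * completions t r (m - 1)) \<le> completions t (Suc r) m"
proof -
  obtain k where k: "m = Suc k" using m by (cases m) auto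
  let ?Y = "completions t r"
  have nn: "0 \<le> ?Y k" for k using completions_nonneg t by simp
  have "kappa t r * ?Y k \<le> ?Y m + real k * ?Y k"
    using kappa_completions_le[OF t, of r k] k by simp
  also have "\<dots> \<le> ?Y m + real m * ?Y k"
    using nn k by (intro add_left_mono mult_right_mono) auto
  finally have "kappa t r * (kappa t r * ?Y k) \<le> kappa t r * (?Y m + real m * ?Y k)"
    using t by (intro mult_left_mono) (auto simp: kappa_nonneg)
  then have "t ^ (m + 1) * ((kappa t r)\<^sup>2 * ?Y k) \<le> t ^ (m + 1) * (kappa t r * (?Y m + real m * ?Y k))"
    using t by (intro mult_left_mono) (auto simp: power2_eq_square algebra_simps)
  also have "\<dots> \<le> completions t (Suc r) m" using completions_ge_open[OF t, of m r] k by simp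
  finally show ?thesis using k by simp
qed

section \<open>The mass of a level and its refinement\<close>

text \<open>
  Since \<open>k - card (restr k p)\<close> is the number of paths at time \<open>k\<close>, this is the part of the Mallows weight
  that is already determined at time \<open>j\<close>.
\<close>

definition weight :: "real \<Rightarrow> nat \<Rightarrow> (nat \<times> nat) set \<Rightarrow> real" where
  "weight t j p = (\<Prod>k=1..j. t ^ (k - card (restr k p)))"

lemma weight_nonneg: "0 \<le> t \<Longrightarrow> 0 \<le> weight t j p"
  by (simp add: weight_def prod_nonneg)

lemma weight_Suc:
  assumes "q \<in> partial_inj (Suc j)"
  shows "weight t (Suc j) q = weight t j (restr j q) * t ^ (Suc j - card q)"
proof -
  have "weight t (Suc j) q = (\<Prod>k=1..j. t ^ (k - card (restr k q))) * t ^ (Suc j - card q)"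
    unfolding weight_def by (simp add: restr_id[OF assms])
  also have "(\<Prod>k=1..j. t ^ (k - card (restr k q))) = weight t j (restr j q)"
    unfolding weight_def by (rule prod.cong) (simp_all add: restr_restr)
  finally show ?thesis .
qed

text \<open>
  The unnormalised expectation of a function of the configuration at time \<open>j\<close>: each configuration
  counts with the total weight of the permutations of \<open>{1..n}\<close> that extend it.
\<close>

definition mass :: "real \<Rightarrow> nat \<Rightarrow> nat \<Rightarrow> ((nat \<times> nat) set \<Rightarrow> real) \<Rightarrow> real" where
  "mass t n j f = (\<Sum>p\<in>partial_inj j. f p * (weight t j p * completions t (n - j) (j - card p)))"

text \<open>
  The sum of \<open>g\<close> over the extensions of \<open>p\<close> by one point, weighted by what the later points
  contribute.  It plays the role of a conditional expectation given \<open>p\<close>, up to the factor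
  \<open>completions t (Suc r) (j - card p)\<close>.
\<close>

definition extension_sum :: "real \<Rightarrow> nat \<Rightarrow> nat \<Rightarrow> ((nat \<times> nat) set \<Rightarrow> real) \<Rightarrow> (nat \<times> nat) set \<Rightarrow> real" where
  "extension_sum t r j g p = (let m = j - card p in
     g p * (t ^ (m + 1) * completions t r (m + 1))
   + (g (insert (Suc j, Suc j) p) + (\<Sum>a\<in>heads j p. g (insert (a, Suc j) p))
        + (\<Sum>b\<in>tails j p. g (insert (Suc j, b) p))) * (t ^ m * completions t r m)
   + (\<Sum>(a, b)\<in>heads j p \<times> tails j p. g (insert (a, Suc j) (insert (Suc j, b) p)))
       * (t ^ (m - 1) * completions t r (m - 1)))"

text \<open>
  The configurations at time \<open>Suc j\<close> are grouped by what was visible one step before.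
\<close>

lemma mass_Suc:
  assumes j: "j < n"
  shows "mass t n (Suc j) g = (\<Sum>p\<in>partial_inj j. weight t j p * extension_sum t (n - Suc j) j g p)"
proof -
  let ?Y = "completions t (n - Suc j)"
  let ?h = "\<lambda>q. g q * (weight t (Suc j) q * ?Y (Suc j - card q))"
  have "mass t n (Suc j) g = (\<Sum>p\<in>partial_inj j. \<Sum>q | q \<in> partial_inj (Suc j) \<and> restr j q = p. ?h q)"
    unfolding mass_def
    by (rule sum.group[symmetric]) (auto simp: finite_partial_inj restr_partial_inj)
  also have "\<dots> = (\<Sum>p\<in>partial_inj j. weight t j p * extension_sum t (n - Suc j) j g p)"
  proof (rule sum.cong)
    fix p assume p: "p \<in> partial_inj j"
    have sub: "p \<subseteq> {1..j} \<times> {1..j}" using p by (auto simp: partial_inj_def)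
    have nc: "(x, Suc j) \<notin> p" "(Suc j, x) \<notin> p" for x using sub by auto
    define m where "m = j - card p"
    have cp: "card p \<le> j" "finite p" using card_heads(2)[OF p] partial_inj_finite[OF p] by auto
    have W: "weight t (Suc j) q = weight t j p * t ^ (Suc j - card q)"
      if "q \<in> {q \<in> partial_inj (Suc j). restr j q = p}" for q
      using weight_Suc[of q j t] that by simp
    have q0: "?h p = weight t j p * (g p * (t ^ (m + 1) * ?Y (m + 1)))"
    proof -
      have "p \<in> {q \<in> partial_inj (Suc j). restr j q = p}" unfolding extensions[OF p] by blast
      moreover have "Suc j - card p = m + 1" using cp by (simp add: m_def)
      ultimately show ?thesis using W[of p] by simp
    qed
    have q1: "?h (insert (Suc j, Suc j) p) = weight t j p * (g (insert (Suc j, Suc j) p) * (t ^ m * ?Y m))"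
    proof -
      have "insert (Suc j, Suc j) p \<in> {q \<in> partial_inj (Suc j). restr j q = p}"
        unfolding extensions[OF p] by blast
      moreover have "Suc j - card (insert (Suc j, Suc j) p) = m" using cp nc by (simp add: m_def)
      ultimately show ?thesis using W[of "insert (Suc j, Suc j) p"] by simp
    qed
    have q2: "?h (insert (a, Suc j) p) = weight t j p * (g (insert (a, Suc j) p) * (t ^ m * ?Y m))"
      if "a \<in> heads j p" for a
    proof -
      have "insert (a, Suc j) p \<in> {q \<in> partial_inj (Suc j). restr j q = p}"
        unfolding extensions[OF p] using that by blast
      moreover have "Suc j - card (insert (a, Suc j) p) = m" using cp nc by (simp add: m_def)
      ultimately show ?thesis using W[of "insert (a, Suc j) p"] by simp
    qed
    have q3: "?h (insert (Suc j, a) p) = weight t j p * (g (insert (Suc j, a) p) * (t ^ m * ?Y m))"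
      if "a \<in> tails j p" for a
    proof -
      have "insert (Suc j, a) p \<in> {q \<in> partial_inj (Suc j). restr j q = p}"
        unfolding extensions[OF p] using that by blast
      moreover have "Suc j - card (insert (Suc j, a) p) = m" using cp nc by (simp add: m_def)
      ultimately show ?thesis using W[of "insert (Suc j, a) p"] by simp
    qed
    have q4: "?h (insert (a, Suc j) (insert (Suc j, b) p)) =
        weight t j p * (g (insert (a, Suc j) (insert (Suc j, b) p)) * (t ^ (m - 1) * ?Y (m - 1)))"
      if ab: "a \<in> heads j p" "b \<in> tails j p" for a b
    proof -
      let ?q = "insert (a, Suc j) (insert (Suc j, b) p)"
      have "(\<lambda>(a, b). insert (a, Suc j) (insert (Suc j, b) p)) (a, b) \<in> {q \<in> partial_inj (Suc j). restr j q = p}"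
        unfolding extensions[OF p] using ab by blast
      then have m: "?q \<in> {q \<in> partial_inj (Suc j). restr j q = p}" by simp
      have "a \<noteq> Suc j" using heads_less[OF ab(1)] by auto
      then have "card ?q = Suc (Suc (card p))" using cp nc by simp
      then have "Suc j - card ?q = m - 1" by (simp add: m_def)
      then show ?thesis using W[OF m] by simp
    qed
    have "(\<Sum>q | q \<in> partial_inj (Suc j) \<and> restr j q = p. ?h q) =
       ?h p + ?h (insert (Suc j, Suc j) p) + (\<Sum>a\<in>heads j p. ?h (insert (a, Suc j) p))
      + (\<Sum>b\<in>tails j p. ?h (insert (Suc j, b) p))
      + (\<Sum>(a, b)\<in>heads j p \<times> tails j p. ?h (insert (a, Suc j) (insert (Suc j, b) p)))"
      by (rule sum_extensions[OF p])
    also have "(\<Sum>a\<in>heads j p. ?h (insert (a, Suc j) p)) =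
       (\<Sum>a\<in>heads j p. weight t j p * (g (insert (a, Suc j) p) * (t ^ m * ?Y m)))"
      by (rule sum.cong[OF refl q2])
    also have "(\<Sum>a\<in>tails j p. ?h (insert (Suc j, a) p)) =
       (\<Sum>a\<in>tails j p. weight t j p * (g (insert (Suc j, a) p) * (t ^ m * ?Y m)))"
      by (rule sum.cong[OF refl q3])
    also have "(\<Sum>(a, b)\<in>heads j p \<times> tails j p. ?h (insert (a, Suc j) (insert (Suc j, b) p))) =
       (\<Sum>(a, b)\<in>heads j p \<times> tails j p.
          weight t j p * (g (insert (a, Suc j) (insert (Suc j, b) p)) * (t ^ (m - 1) * ?Y (m - 1))))"
      by (rule sum.cong[OF refl]) (clarsimp simp only: q4 mem_Times_iff fst_conv snd_conv split: prod.split)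
    finally show "(\<Sum>q | q \<in> partial_inj (Suc j) \<and> restr j q = p. ?h q) = weight t j p * extension_sum t (n - Suc j) j g p"
      unfolding extension_sum_def Let_def m_def[symmetric] q0 q1
      by (simp add: case_prod_unfold distrib_left distrib_right sum_distrib_left sum_distrib_right mult.assoc)
  qed simp
  finally show ?thesis .
qed

lemma extension_sum_const:
  assumes p: "p \<in> partial_inj j"
  shows "extension_sum t r j (\<lambda>_. x) p = x * completions t (Suc r) (j - card p)"
proof -
  define m where "m = j - card p"
  have "card (heads j p) = m" "card (tails j p) = m"
    using card_heads[OF p] card_tails[OF p] by (simp_all add: m_def)
  then show ?thesis
    unfolding extension_sum_def Let_def m_def[symmetric]
    by (simp add: case_prod_unfold card_cartesian_product algebra_simps power2_eq_square)
qed

text \<open>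
  Only the joins are averaged; for the other extensions a pointwise bound suffices.  This is the form
  needed when the joins contain a few exceptional pairs that compensate each other.
\<close>

lemma extension_sum_ge:
  assumes p: "p \<in> partial_inj j" and t: "0 \<le> t"
    and "x \<le> g p" "x \<le> g (insert (Suc j, Suc j) p)"
    and "\<And>a. a \<in> heads j p \<Longrightarrow> x \<le> g (insert (a, Suc j) p)"
    and "\<And>b. b \<in> tails j p \<Longrightarrow> x \<le> g (insert (Suc j, b) p)"
    and "x * (real (j - card p))\<^sup>2 \<le> (\<Sum>(a, b)\<in>heads j p \<times> tails j p. g (insert (a, Suc j) (insert (Suc j, b) p)))"
  shows "x * completions t (Suc r) (j - card p) \<le> extension_sum t r j g p"
proof -
  define m where "m = j - card p"
  have nn: "0 \<le> t ^ i * completions t r k" for i k using completions_nonneg t by simp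
  have "x * real m = (\<Sum>a\<in>heads j p. x)" using card_heads[OF p] by (simp add: m_def)
  also have "\<dots> \<le> (\<Sum>a\<in>heads j p. g (insert (a, Suc j) p))" using assms by (intro sum_mono) auto
  finally have h: "x * real m \<le> (\<Sum>a\<in>heads j p. g (insert (a, Suc j) p))" .
  have "x * real m = (\<Sum>a\<in>tails j p. x)" using card_tails[OF p] by (simp add: m_def)
  also have "\<dots> \<le> (\<Sum>b\<in>tails j p. g (insert (Suc j, b) p))" using assms by (intro sum_mono) auto
  finally have t: "x * real m \<le> (\<Sum>b\<in>tails j p. g (insert (Suc j, b) p))" .
  have "x * completions t (Suc r) m = x * (t ^ (m + 1) * completions t r (m + 1))
     + (x + x * real m + x * real m) * (t ^ m * completions t r m)
     + (x * (real m)\<^sup>2) * (t ^ (m - 1) * completions t r (m - 1))"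
    by (simp add: algebra_simps)
  also have "\<dots> \<le> extension_sum t r j g p"
    unfolding extension_sum_def Let_def m_def[symmetric]
    using assms(3,4,7) h t by (intro add_mono mult_right_mono nn) (auto simp: m_def)
  finally show ?thesis by (simp add: m_def)
qed

lemma extension_sum_diff: "extension_sum t r j (\<lambda>q. g q - h q) p = extension_sum t r j g p - extension_sum t r j h p"
  by (simp add: extension_sum_def Let_def case_prod_unfold sum_subtractf algebra_simps)

lemma mass_one_Suc:
  assumes "j < n"
  shows "mass t n (Suc j) (\<lambda>_. 1) = mass t n j (\<lambda>_. 1)"
proof -
  have "n - j = Suc (n - Suc j)" using assms by simp
  then show ?thesis
    unfolding mass_Suc[OF assms] mass_def[of t n j]
    by (intro sum.cong) (simp_all only: extension_sum_const mult_1)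
qed

lemma mass_one:
  assumes "j \<le> n"
  shows "mass t n j (\<lambda>_. 1) = mass t n 0 (\<lambda>_. 1)"
  using assms by (induction j) (simp_all add: mass_one_Suc)

lemma mass_mono:
  assumes "0 \<le> t" "\<And>p. p \<in> partial_inj j \<Longrightarrow> f p \<le> g p"
  shows "mass t n j f \<le> mass t n j g"
  unfolding mass_def using assms
  by (intro sum_mono mult_right_mono) (auto simp: weight_nonneg completions_nonneg)

lemma mass_diff: "mass t n j (\<lambda>p. f p - g p) = mass t n j f - mass t n j g"
  by (simp add: mass_def left_diff_distrib sum_subtractf)

lemma mass_add: "mass t n j (\<lambda>p. f p + g p) = mass t n j f + mass t n j g"
  by (simp add: mass_def distrib_right sum.distrib)

lemma mass_cmult: "mass t n j (\<lambda>p. x * f p) = x * mass t n j f"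
  by (simp add: mass_def sum_distrib_left mult.assoc)

section \<open>Closing the cycle of a point\<close>

text \<open>
  In a partial injection a point is on a path exactly when it cannot return to itself.
\<close>

abbreviation on_cycle :: "nat \<Rightarrow> (nat \<times> nat) set \<Rightarrow> bool" where
  "on_cycle s p \<equiv> (s, s) \<in> p\<^sup>+"

lemma unique_closing_pair:
  assumes p: "p \<in> partial_inj j" and s: "s \<in> {1..j}" and op: "\<not> on_cycle s p"
  shows "\<exists>a\<in>heads j p. \<exists>b\<in>tails j p.
    (\<forall>a'\<in>heads j p. (s, a') \<in> p\<^sup>* \<longleftrightarrow> a' = a) \<and> (\<forall>b'\<in>tails j p. (b', s) \<in> p\<^sup>* \<longleftrightarrow> b' = b)"
proof -
  obtain a where a: "a \<in> heads j p" "(s, a) \<in> p\<^sup>*" using head_exists[OF assms] by blast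
  obtain b where b: "b \<in> tails j p" "(b, s) \<in> p\<^sup>*" using tail_exists[OF assms] by blast
  have "\<forall>a'\<in>heads j p. (s, a') \<in> p\<^sup>* \<longleftrightarrow> a' = a"
    using head_unique[OF p _ a(2) _ a(1)] a(2) by auto
  moreover have "\<forall>b'\<in>tails j p. (b', s) \<in> p\<^sup>* \<longleftrightarrow> b' = b"
    using tail_unique[OF p _ b(2) _ b(1)] b(2) by auto
  ultimately show ?thesis using a(1) b(1) by (intro bexI conjI)
qed

lemma sum_of_bool_pair:
  assumes "finite A" "finite B" "a \<in> A" "b \<in> B"
  shows "(\<Sum>(x, y)\<in>A \<times> B. of_bool (x = a \<and> y = b)) = (1::real)"
proof -
  have "(\<Sum>(x, y)\<in>A \<times> B. of_bool (x = a \<and> y = b)) = (\<Sum>z\<in>A \<times> B. if z = (a, b) then 1 else (0::real))"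
    by (rule sum.cong) auto
  then show ?thesis using assms by (simp add: sum.delta)
qed

text \<open>
  Exactly one join closes the cycle of a point that is on a path.
\<close>

lemma extension_sum_on_cycle_open:
  assumes p: "p \<in> partial_inj j" and s: "s \<in> {1..j}" and op: "\<not> on_cycle s p"
  shows "extension_sum t r j (\<lambda>q. of_bool (on_cycle s q)) p =
    t ^ (j - card p - 1) * completions t r (j - card p - 1)"
proof -
  obtain a b where ab: "a \<in> heads j p" "b \<in> tails j p" "\<forall>a'\<in>heads j p. (s, a') \<in> p\<^sup>* \<longleftrightarrow> a' = a"
    "\<forall>b'\<in>tails j p. (b', s) \<in> p\<^sup>* \<longleftrightarrow> b' = b"
    using unique_closing_pair[OF assms] by (elim bexE conjE)
  have sj: "s \<le> j" using s by simp
  have "(\<Sum>(x, y)\<in>heads j p \<times> tails j p. of_bool (on_cycle s (insert (x, Suc j) (insert (Suc j, y) p))))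
     = (\<Sum>(x, y)\<in>heads j p \<times> tails j p. of_bool (x = a \<and> y = b) :: real)"
  proof (rule sum.cong[OF refl], clarify)
    fix x y assume xy: "x \<in> heads j p" "y \<in> tails j p"
    have "on_cycle s (insert (x, Suc j) (insert (Suc j, y) p)) \<longleftrightarrow> x = a \<and> y = b"
      using cycle_in_extension(4)[OF p sj, of x y] heads_less[OF xy(1)] op
        bspec[OF ab(3) xy(1)] bspec[OF ab(4) xy(2)] by simp
    then show "of_bool (on_cycle s (insert (x, Suc j) (insert (Suc j, y) p))) = (of_bool (x = a \<and> y = b) :: real)"
      by simp
  qed
  also have "\<dots> = 1" by (rule sum_of_bool_pair) (use ab in auto)
  finally show ?thesis
    using op by (simp add: extension_sum_def Let_def cycle_in_extension(1-3)[OF p sj])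
qed

lemma extension_sum_on_cycle_absorbing:
  assumes p: "p \<in> partial_inj j" and cl: "on_cycle s p"
  shows "extension_sum t r j (\<lambda>q. of_bool (on_cycle s q)) p = completions t (Suc r) (j - card p)"
proof -
  have "on_cycle s q" if "p \<subseteq> q" for q using cl trancl_mono[OF cl that] by simp
  then have "extension_sum t r j (\<lambda>q. of_bool (on_cycle s q)) p = extension_sum t r j (\<lambda>q. 1) p"
    unfolding extension_sum_def Let_def by (simp only: subset_insertI subset_insertI2 subset_refl of_bool_eq)
  then show ?thesis by (simp add: extension_sum_const[OF p])
qed

text \<open>
  A point on a cycle stays there, so the loss of mass is the weight of the closing joins.
\<close>

lemma open_mass_drop:
  assumes s: "s \<in> {1..j}" and j: "j < n"
  shows "mass t n j (\<lambda>p. of_bool (\<not> on_cycle s p)) - mass t n (Suc j) (\<lambda>p. of_bool (\<not> on_cycle s p)) =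
    (\<Sum>p\<in>partial_inj j. of_bool (\<not> on_cycle s p) *
       (weight t j p * (t ^ (j - card p - 1) * completions t (n - Suc j) (j - card p - 1))))"
proof -
  have nj: "n - j = Suc (n - Suc j)" using j by simp
  have e: "of_bool (\<not> on_cycle s q) = 1 - (of_bool (on_cycle s q) :: real)" for q by simp
  have st: "extension_sum t r j (\<lambda>q. of_bool (\<not> on_cycle s q)) p =
      completions t (Suc r) (j - card p) - extension_sum t r j (\<lambda>q. of_bool (on_cycle s q)) p"
    if "p \<in> partial_inj j" for p r
    unfolding e extension_sum_diff extension_sum_const[OF that] by simp
  show ?thesis unfolding mass_Suc[OF j] mass_def[of t n j] nj sum_subtractf[symmetric]
  proof (rule sum.cong[OF refl])
    fix p assume p: "p \<in> partial_inj j"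
    show "of_bool (\<not> on_cycle s p) * (weight t j p * completions t (Suc (n - Suc j)) (j - card p)) -
         weight t j p * extension_sum t (n - Suc j) j (\<lambda>q. of_bool (\<not> on_cycle s q)) p =
         of_bool (\<not> on_cycle s p) *
         (weight t j p * (t ^ (j - card p - 1) * completions t (n - Suc j) (j - card p - 1)))"
    proof (cases "on_cycle s p")
      case True
      then show ?thesis unfolding st[OF p] extension_sum_on_cycle_absorbing[OF p True] by simp
    next
      case False
      then show ?thesis unfolding st[OF p] extension_sum_on_cycle_open[OF p s False]
        by (simp add: right_diff_distrib)
    qed
  qed
qed

lemma heads_nonempty_if_open:
  assumes p: "p \<in> partial_inj j" and s: "s \<in> {1..j}" and op: "\<not> on_cycle s p"
  shows "1 \<le> j - card p"
proof -
  have "heads j p \<noteq> {}" using head_exists[OF assms] by blast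
  then have "card (heads j p) \<noteq> 0" by simp
  then show ?thesis using card_heads(1)[OF p] by linarith
qed

text \<open>
  By \<open>completions_ge_close\<close> the closing join takes only a small part of the weight, at every level \<open>m\<close>.
\<close>

lemma open_mass_drop_le:
  assumes s: "s \<in> {1..j}" and j: "j < n" and t: "0 < t" "t \<le> 1"
  shows "t\<^sup>2 * (kappa t (n - Suc j))\<^sup>2 *
      (mass t n j (\<lambda>p. of_bool (\<not> on_cycle s p)) - mass t n (Suc j) (\<lambda>p. of_bool (\<not> on_cycle s p)))
     \<le> mass t n j (\<lambda>p. of_bool (\<not> on_cycle s p))"
  unfolding open_mass_drop[OF s j] unfolding mass_def sum_distrib_left
proof (rule sum_mono)
  fix p assume p: "p \<in> partial_inj j"
  have nj: "n - j = Suc (n - Suc j)" using j by simp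
  define m where "m = j - card p"
  define r where "r = n - Suc j"
  show "t\<^sup>2 * (kappa t (n - Suc j))\<^sup>2 *
      (of_bool (\<not> on_cycle s p) * (weight t j p * (t ^ (j - card p - 1) * completions t (n - Suc j) (j - card p - 1))))
      \<le> of_bool (\<not> on_cycle s p) * (weight t j p * completions t (n - j) (j - card p))"
  proof (cases "on_cycle s p")
    case False
    then have m: "1 \<le> m" using heads_nonempty_if_open[OF p s] by (simp add: m_def)
    have "t\<^sup>2 * t ^ (m - 1) = t ^ (m + 1)"
      using m by (simp add: power_add[symmetric])
    then have "t\<^sup>2 * (kappa t r)\<^sup>2 * (t ^ (m - 1) * completions t r (m - 1)) =
       t ^ (m + 1) * ((kappa t r)\<^sup>2 * completions t r (m - 1))"
      by (metis mult.assoc mult.left_commute)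
    also have "\<dots> \<le> completions t (Suc r) m"
      using completions_ge_close[of t m r] t m by simp
    finally have "weight t j p * (t\<^sup>2 * (kappa t r)\<^sup>2 * (t ^ (m - 1) * completions t r (m - 1)))
       \<le> weight t j p * completions t (Suc r) m"
      using t by (intro mult_left_mono) (auto simp: weight_nonneg)
    then show ?thesis using False unfolding nj m_def[symmetric] r_def[symmetric]
      by (simp add: mult.left_commute mult.assoc)
  qed simp
qed

text \<open>
  Each head belongs to one path and hence is connected to only one tail.
\<close>

lemma connected_pairs_le:
  assumes p: "p \<in> partial_inj j"
  shows "(\<Sum>(a, b)\<in>heads j p \<times> tails j p. of_bool ((b, a) \<in> p\<^sup>*)) \<le> real (j - card p)"
proof -
  have "(\<Sum>(a, b)\<in>heads j p \<times> tails j p. of_bool ((b, a) \<in> p\<^sup>*)) =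
     (\<Sum>a\<in>heads j p. \<Sum>b\<in>tails j p. of_bool ((b, a) \<in> p\<^sup>*) :: real)"
    by (rule sum.cartesian_product[symmetric])
  also have "\<dots> \<le> (\<Sum>a\<in>heads j p. 1)"
  proof (rule sum_mono)
    fix a assume "a \<in> heads j p"
    have "card (tails j p \<inter> {b. (b, a) \<in> p\<^sup>*}) \<le> Suc 0"
      using tail_unique[OF p] by (subst card_le_Suc0_iff_eq) auto
    then show "(\<Sum>b\<in>tails j p. of_bool ((b, a) \<in> p\<^sup>*)) \<le> (1::real)"
      by (simp add: of_bool_def sum.If_cases)
  qed
  finally show ?thesis using card_heads(1)[OF p] by simp
qed

text \<open>
  The new point is on a cycle as soon as it appears only if it is a loop or joins the two ends of one of the \<open>m\<close>
  paths.  These are \<open>m + 1\<close> extensions instead of the single closing join of later steps, which is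
  why only the first power of \<open>kappa\<close> appears.
\<close>

lemma on_cycle_mass_start:
  assumes s: "s \<in> {1..n}" and t: "0 < t" "t \<le> 1"
  shows "t\<^sup>2 * kappa t (n - s) * mass t n s (\<lambda>p. of_bool (on_cycle s p)) \<le> mass t n 0 (\<lambda>_. 1)"
proof -
  obtain j where j: "s = Suc j" "j < n" using s by (cases s) auto
  have nj: "n - j = Suc (n - Suc j)" using j by simp
  have "t\<^sup>2 * kappa t (n - s) * mass t n s (\<lambda>p. of_bool (on_cycle s p)) \<le> mass t n j (\<lambda>_. 1)"
    unfolding j(1) mass_Suc[OF j(2)] unfolding mass_def sum_distrib_left
  proof (rule sum_mono)
    fix p assume p: "p \<in> partial_inj j"
    define m where "m = j - card p"
    define r where "r = n - Suc j"
    have nn: "0 \<le> t ^ i * completions t r k" for i k using completions_nonneg t by simp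
    have hc: "(\<Sum>a\<in>heads j p. of_bool (on_cycle (Suc j) (insert (a, Suc j) p)) :: real) = 0"
      using new_point_cycle(2)[OF p] heads_less by (intro sum.neutral) fastforce
    have tc: "(\<Sum>a\<in>tails j p. of_bool (on_cycle (Suc j) (insert (Suc j, a) p)) :: real) = 0"
      using new_point_cycle(3)[OF p] tails_less by (intro sum.neutral) fastforce
    have jc: "(\<Sum>(a, b)\<in>heads j p \<times> tails j p. of_bool (on_cycle (Suc j) (insert (a, Suc j) (insert (Suc j, b) p))))
       = (\<Sum>(a, b)\<in>heads j p \<times> tails j p. of_bool ((b, a) \<in> p\<^sup>*) :: real)"
    proof (rule sum.cong[OF refl])
      fix x assume "x \<in> heads j p \<times> tails j p"
      then have "fst x \<le> j" "snd x \<le> j" using heads_less tails_less by auto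
      then show "(case x of (a, b) \<Rightarrow> of_bool (on_cycle (Suc j) (insert (a, Suc j) (insert (Suc j, b) p))))
        = (case x of (a, b) \<Rightarrow> (of_bool ((b, a) \<in> p\<^sup>*) :: real))"
        using new_point_cycle(4)[OF p, of "fst x" "snd x"] by (simp add: case_prod_unfold)
    qed
    have "on_cycle (Suc j) (insert (Suc j, Suc j) p)" by blast
    then have "extension_sum t r j (\<lambda>q. of_bool (on_cycle (Suc j) q)) p =
       t ^ m * completions t r m + (\<Sum>(a, b)\<in>heads j p \<times> tails j p. of_bool ((b, a) \<in> p\<^sup>*)) * (t ^ (m - 1) * completions t r (m - 1))"
      unfolding extension_sum_def Let_def hc tc jc m_def[symmetric] using new_point_cycle(1)[OF p] by simp
    also have "\<dots> \<le> t ^ m * completions t r m + real m * (t ^ (m - 1) * completions t r (m - 1))"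
      using connected_pairs_le[OF p] nn by (intro add_left_mono mult_right_mono) (auto simp: m_def)
    finally have st: "extension_sum t r j (\<lambda>q. of_bool (on_cycle (Suc j) q)) p
      \<le> t ^ m * completions t r m + real m * (t ^ (m - 1) * completions t r (m - 1))" .
    have K: "0 \<le> t\<^sup>2 * kappa t r" using t by (simp add: kappa_nonneg)
    have "t\<^sup>2 * kappa t r * extension_sum t r j (\<lambda>q. of_bool (on_cycle (Suc j) q)) p \<le>
       t\<^sup>2 * kappa t r * (t ^ m * completions t r m + real m * (t ^ (m - 1) * completions t r (m - 1)))"
      by (rule mult_left_mono[OF st K])
    also have "\<dots> = kappa t r * (t\<^sup>2 * t ^ m * completions t r m + real m * (t\<^sup>2 * t ^ (m - 1) * completions t r (m - 1)))"
      by (simp add: algebra_simps)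
    also have "\<dots> \<le> kappa t r * (t ^ (m + 1) * completions t r m + real m * (t ^ (m + 1) * completions t r (m - 1)))"
    proof (rule mult_left_mono, rule add_mono)
      have "t\<^sup>2 * t ^ m \<le> t ^ (m + 1)"
        using t by (subst power_add[symmetric]) (rule power_decreasing, auto)
      then show "t\<^sup>2 * t ^ m * completions t r m \<le> t ^ (m + 1) * completions t r m"
        using completions_nonneg t by (intro mult_right_mono) auto
      show "real m * (t\<^sup>2 * t ^ (m - 1) * completions t r (m - 1)) \<le> real m * (t ^ (m + 1) * completions t r (m - 1))"
        by (cases m) (auto simp: power2_eq_square)
    qed (use t in \<open>auto simp: kappa_nonneg\<close>)
    also have "\<dots> = t ^ (m + 1) * (kappa t r * (completions t r m + real m * completions t r (m - 1)))"
      by (simp add: algebra_simps)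
    also have "\<dots> \<le> completions t (Suc r) m" using completions_ge_open[of t m r] t by simp
    finally have "weight t j p * (t\<^sup>2 * kappa t r * extension_sum t r j (\<lambda>q. of_bool (on_cycle (Suc j) q)) p)
       \<le> weight t j p * completions t (Suc r) m"
      using t by (intro mult_left_mono) (auto simp: weight_nonneg)
    then show "t\<^sup>2 * kappa t (n - Suc j) * (weight t j p * extension_sum t (n - Suc j) j (\<lambda>q. of_bool (on_cycle (Suc j) q)) p)
      \<le> 1 * (weight t j p * completions t (n - j) (j - card p))"
      unfolding nj m_def[symmetric] r_def[symmetric] by (simp add: mult.left_commute)
  qed
  then show ?thesis using mass_one[of j n t] j by simp
qed

section \<open>Two points in the same cycle\<close>

definition linked :: "nat \<Rightarrow> nat \<Rightarrow> (nat \<times> nat) set \<Rightarrow> bool" where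
  "linked s v p \<longleftrightarrow> (s, v) \<in> p\<^sup>* \<or> (v, s) \<in> p\<^sup>*"

text \<open>
  Twice the conditional probability that \<open>s\<close> and \<open>v\<close> end in the same cycle: one if they are linked, one
  half if they lie on two different paths, and zero if one of them is on a cycle
  that misses the other.
\<close>

definition link_potential :: "nat \<Rightarrow> nat \<Rightarrow> (nat \<times> nat) set \<Rightarrow> real" where
  "link_potential s v p = (if linked s v p then 2 else of_bool (\<not> on_cycle s p \<and> \<not> on_cycle v p))"

text \<open>
  The potential is a submartingale.  The only interesting case is that of two different paths, with
  head \<open>a\<close> and tail \<open>b\<close> for \<open>s\<close>, head \<open>c\<close> and tail \<open>d\<close> for \<open>v\<close>: the joins of \<open>a\<close> to \<open>d\<close> and of \<open>c\<close> to \<open>b\<close>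
  raise the potential from one to two, those of \<open>a\<close> to \<open>b\<close> and of \<open>c\<close> to \<open>d\<close> lower it to zero at
  worst, and all joins have the same weight.
\<close>

lemma extension_sum_link_potential:
  assumes p: "p \<in> partial_inj j" and s: "s \<in> {1..j}" and v: "v \<in> {1..j}" and t: "0 \<le> t"
  shows "link_potential s v p * completions t (Suc r) (j - card p) \<le> extension_sum t r j (link_potential s v) p"
proof -
  let ?f = "link_potential s v"
  have f0: "0 \<le> ?f q" for q by (simp add: link_potential_def)
  consider "linked s v p" | "\<not> linked s v p" "on_cycle s p \<or> on_cycle v p"
    | "\<not> linked s v p" "\<not> on_cycle s p" "\<not> on_cycle v p" by blast
  then show ?thesis
  proof cases
    case 1
    have two: "?f q = 2" if "p \<subseteq> q" for q
      using 1 rtrancl_mono[OF that] by (auto simp: link_potential_def linked_def)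
    have "extension_sum t r j ?f p = extension_sum t r j (\<lambda>q. 2) p"
        unfolding extension_sum_def Let_def by (simp only: two subset_insertI subset_insertI2 subset_refl)
    then show ?thesis using two[of p] by (simp only: extension_sum_const[OF p] subset_refl)
  next
    case 2
    then have "?f p = 0" by (auto simp: link_potential_def)
    then show ?thesis using extension_sum_ge[OF p t, of 0 ?f r] f0
      by (simp add: sum_nonneg case_prod_unfold)
  next
    case 3
    have sj: "s \<le> j" and vj: "v \<le> j" using s v by auto
    obtain a b where ab: "a \<in> heads j p" "b \<in> tails j p" 
      "\<forall>a'\<in>heads j p. (s, a') \<in> p\<^sup>* \<longleftrightarrow> a' = a"
      "\<forall>b'\<in>tails j p. (b', s) \<in> p\<^sup>* \<longleftrightarrow> b' = b"
      using unique_closing_pair[OF p s 3(2)] by (elim bexE conjE)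
    have ab': "(s, a) \<in> p\<^sup>*" "(b, s) \<in> p\<^sup>*" using ab by simp_all
    obtain c d where cd: "c \<in> heads j p" "d \<in> tails j p" 
      "\<forall>a'\<in>heads j p. (v, a') \<in> p\<^sup>* \<longleftrightarrow> a' = c"
      "\<forall>b'\<in>tails j p. (b', v) \<in> p\<^sup>* \<longleftrightarrow> b' = d"
      using unique_closing_pair[OF p v 3(3)] by (elim bexE conjE)
    have cd': "(v, c) \<in> p\<^sup>*" "(d, v) \<in> p\<^sup>*" using cd by simp_all
    have sv: "single_valued p" "single_valued (p\<inverse>)" using p by (auto simp: partial_inj_def)
    have ac: "a \<noteq> c"
    proof
      assume "a = c"
      then have "(a, s) \<in> (p\<inverse>)\<^sup>*" "(a, v) \<in> (p\<inverse>)\<^sup>*" using ab'(1) cd'(1) by (simp_all add: rtrancl_converse)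
      then have "linked s v p"
        using single_valued_confluent[OF sv(2)] by (auto simp: linked_def rtrancl_converse)
      then show False using 3 by simp
    qed
    have bd: "b \<noteq> d"
      using single_valued_confluent[OF sv(1), of b s v] 3(1) ab'(2) cd'(2) by (auto simp: linked_def)
    have one: "1 \<le> ?f q" if "\<not> on_cycle s q" "\<not> on_cycle v q" for q
      using that by (simp add: link_potential_def)
    have fp: "?f p = 1" using 3 by (simp add: link_potential_def)
    have join: "1 + of_bool (x = a \<and> y = d) + of_bool (x = c \<and> y = b)
        - of_bool (x = a \<and> y = b) - of_bool (x = c \<and> y = d) \<le> ?f (insert (x, Suc j) (insert (Suc j, y) p))"
      if xy: "x \<in> heads j p" "y \<in> tails j p" for x y
    proof -
      let ?q = "insert (x, Suc j) (insert (Suc j, y) p)"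
      have up: "(e, f) \<in> p\<^sup>* \<Longrightarrow> (e, f) \<in> ?q\<^sup>*" for e f
        by (meson rtrancl_mono subset_insertI subset_insertI2 subsetD)
      have xj: "x \<le> j" using heads_less[OF xy(1)] by simp
      have xcy: "(x, y) \<in> ?q\<^sup>*"
        by (meson insertI1 insertI2 r_into_rtrancl rtrancl_trans)
      have cs: "on_cycle s ?q \<longleftrightarrow> x = a \<and> y = b"
        using cycle_in_extension(4)[OF p sj xj, of y] 3(2)
          bspec[OF ab(3) xy(1)] bspec[OF ab(4) xy(2)] by simp
      have cv: "on_cycle v ?q \<longleftrightarrow> x = c \<and> y = d"
        using cycle_in_extension(4)[OF p vj xj, of y] 3(3)
          bspec[OF cd(3) xy(1)] bspec[OF cd(4) xy(2)] by simp
      consider "x = a \<and> y = d" | "x = c \<and> y = b" | "x = a \<and> y = b" | "x = c \<and> y = d"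
        | "\<not> (x = a \<and> y = d)" "\<not> (x = c \<and> y = b)" "\<not> (x = a \<and> y = b)" "\<not> (x = c \<and> y = d)"
        by blast
      then show ?thesis
      proof cases
        case 1
        have "(s, v) \<in> ?q\<^sup>*" using up[OF ab'(1)] up[OF cd'(2)] xcy 1 by (meson rtrancl_trans)
        then have "?f ?q = 2" by (simp add: link_potential_def linked_def)
        then show ?thesis using 1 ac bd by simp
      next
        case 2
        have "(v, s) \<in> ?q\<^sup>*" using up[OF ab'(2)] up[OF cd'(1)] xcy 2 by (meson rtrancl_trans)
        then have "?f ?q = 2" by (simp add: link_potential_def linked_def)
        then show ?thesis using 2 ac bd by simp
      next
        case 3
        then show ?thesis using ac bd f0[of ?q] by simp
      next
        case 4
        then show ?thesis using ac bd f0[of ?q] by simp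
      next
        case 5
        have "1 \<le> ?f ?q" by (rule one) (simp_all only: cs cv 5 simp_thms)
        then show ?thesis by (simp only: 5 of_bool_eq)
      qed
    qed
    let ?P = "heads j p \<times> tails j p"
    have "1 * (real (j - card p))\<^sup>2 = real (card ?P)"
      using card_heads(1)[OF p] card_tails[OF p] by (simp add: card_cartesian_product power2_eq_square)
    also have "\<dots> = (\<Sum>(x, y)\<in>?P. 1) + (\<Sum>(x, y)\<in>?P. of_bool (x = a \<and> y = d)) + (\<Sum>(x, y)\<in>?P. of_bool (x = c \<and> y = b))
        - (\<Sum>(x, y)\<in>?P. of_bool (x = a \<and> y = b)) - (\<Sum>(x, y)\<in>?P. of_bool (x = c \<and> y = d))"
      using ab cd by (subst (1 2 3 4) sum_of_bool_pair) auto
    also have "\<dots> = (\<Sum>(x, y)\<in>?P. 1 + of_bool (x = a \<and> y = d) + of_bool (x = c \<and> y = b)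
        - of_bool (x = a \<and> y = b) - of_bool (x = c \<and> y = d))"
      by (simp only: case_prod_unfold sum.distrib sum_subtractf)
    also have "\<dots> \<le> (\<Sum>(x, y)\<in>?P. ?f (insert (x, Suc j) (insert (Suc j, y) p)))"
      using join by (intro sum_mono) (clarsimp simp only: mem_Sigma_iff split: prod.split)
    finally have S: "1 * (real (j - card p))\<^sup>2 \<le> (\<Sum>(x, y)\<in>?P. ?f (insert (x, Suc j) (insert (Suc j, y) p)))" .
    show ?thesis unfolding fp
      by (rule extension_sum_ge[OF p t]) (use 3 S in \<open>auto intro!: one simp only: cycle_in_extension(1-3)[OF p sj]
         cycle_in_extension(1-3)[OF p vj] fp\<close>)
  qed
qed

lemma mass_link_potential_mono:
  assumes s: "s \<in> {1..k}" and v: "v \<in> {1..k}" and t: "0 \<le> t" and kn: "k \<le> j" "j \<le> n"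
  shows "mass t n k (link_potential s v) \<le> mass t n j (link_potential s v)"
  using kn
proof (induction j rule: dec_induct)
  case (step i)
  have ni: "n - i = Suc (n - Suc i)" using step by simp
  have "mass t n i (link_potential s v) \<le> mass t n (Suc i) (link_potential s v)"
    unfolding mass_Suc[OF Suc_le_lessD[OF step.prems]] unfolding mass_def ni
  proof (rule sum_mono)
    fix p assume p: "p \<in> partial_inj i"
    have "weight t i p * (link_potential s v p * completions t (Suc (n - Suc i)) (i - card p))
       \<le> weight t i p * extension_sum t (n - Suc i) i (link_potential s v) p"
      using s v step t
      by (intro mult_left_mono extension_sum_link_potential[OF p]) (auto simp: weight_nonneg)
    then show "link_potential s v p * (weight t i p * completions t (Suc (n - Suc i)) (i - card p))
       \<le> weight t i p * extension_sum t (n - Suc i) i (link_potential s v) p"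
      by (simp only: mult.left_commute)
  qed
  then show ?case using step by simp
qed simp

text \<open>
  At time \<open>n\<close> every permutation consists of cycles only, so the potential is positive
  only for linked points, where it is two.
\<close>

lemma mass_linked_ge:
  assumes s: "s \<in> {1..k}" and v: "v \<in> {1..k}" and t: "0 \<le> t" and kn: "k \<le> n"
  shows "mass t n k (\<lambda>_. 1) - mass t n k (\<lambda>p. of_bool (on_cycle s p)) - mass t n k (\<lambda>p. of_bool (on_cycle v p))
    \<le> 2 * mass t n n (\<lambda>p. of_bool (linked s v p))"
proof -
  have "mass t n k (\<lambda>_. 1) - mass t n k (\<lambda>p. of_bool (on_cycle s p)) - mass t n k (\<lambda>p. of_bool (on_cycle v p))
     \<le> mass t n k (link_potential s v)"
    unfolding mass_diff[symmetric] by (rule mass_mono[OF t]) (simp add: link_potential_def)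
  also have "\<dots> \<le> mass t n n (link_potential s v)"
    by (rule mass_link_potential_mono[OF s v t kn order_refl])
  also have "\<dots> \<le> mass t n n (\<lambda>p. 2 * of_bool (linked s v p))"
    unfolding mass_def
  proof (rule sum_mono)
    fix p assume p: "p \<in> partial_inj n"
    show "link_potential s v p * (weight t n p * completions t (n - n) (n - card p))
      \<le> 2 * of_bool (linked s v p) * (weight t n p * completions t (n - n) (n - card p))"
    proof (cases "n - card p = 0")
      case True
      then have "on_cycle s p" using heads_nonempty_if_open[OF p, of s] s kn by force
      then show ?thesis using t by (simp add: link_potential_def)
    qed simp
  qed
  finally show ?thesis by (simp only: mass_cmult)
qed

section \<open>Few paths while a point stays on a path\<close>

text \<open>
  The new arc is missing before time \<open>max a b\<close> in both configurations, and from then on it reduces the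
  number of paths by one.
\<close>

lemma weight_insert:
  assumes p: "p \<in> partial_inj j" and a: "a \<in> heads j p" and b: "b \<in> tails j p"
  shows "weight t j p = weight t j (insert (a, b) p) * t ^ (Suc j - max a b)"
proof -
  have ab: "1 \<le> a" "a \<le> j" "1 \<le> b" "b \<le> j" using heads_less[OF a] tails_less[OF b] by auto
  have nab: "(a, b) \<notin> p" using a by (auto simp: heads_def)
  have p': "insert (a, b) p \<in> partial_inj j"
    using p a b by (auto simp: partial_inj_def heads_def tails_def single_valued_def)
  have e: "t ^ (k - card (restr k p)) =
      t ^ (k - card (restr k (insert (a, b) p))) * (if max a b \<le> k then t else 1)" for k
  proof (cases "max a b \<le> k")
    case True
    then have r: "restr k (insert (a, b) p) = insert (a, b) (restr k p)"
      using ab by (auto simp: restr_def)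
    have "finite (restr k p)" using partial_inj_finite[OF p] by (simp add: restr_def)
    then have c: "card (restr k (insert (a, b) p)) = Suc (card (restr k p))"
      using nab unfolding r by (simp add: restr_def)
    have "card (restr k (insert (a, b) p)) \<le> k"
      using card_heads(2)[OF restr_partial_inj[OF p']] .
    then have "k - card (restr k p) = Suc (k - card (restr k (insert (a, b) p)))"
      using c by simp
    then show ?thesis using True by simp
  next
    case False
    then have "restr k (insert (a, b) p) = restr k p" by (auto simp: restr_def)
    with False show ?thesis by (simp only: if_False mult_1_right)
  qed
  have "weight t j p = weight t j (insert (a, b) p) * (\<Prod>k=1..j. if max a b \<le> k then t else 1)"
    unfolding weight_def prod.distrib[symmetric] using e by simp
  also have "(\<Prod>k=1..j. if max a b \<le> k then t else 1) = (\<Prod>k\<in>{max a b..j}. t)"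
    by (rule prod.mono_neutral_cong_right) (use ab in auto)
  finally show ?thesis by simp
qed

lemma kappa_le:
  assumes "0 < t" "t < 1"
  shows "kappa t r \<le> t / (1 - t)"
proof (induction r)
  case (Suc r)
  have "t * (kappa t r + 1) \<le> t * (t / (1 - t) + 1)" using Suc assms by (intro mult_left_mono) auto
  also have "\<dots> = t / (1 - t)" using assms by (simp add: field_simps)
  finally show ?case by (simp add: kappa_Suc)
qed (use assms in \<open>simp add: kappa_def\<close>)

text \<open>
  Since \<open>p\<close> is injective, every number is the maximum of the ends of at most two arcs, so two
  geometric series dominate the sum.
\<close>

lemma sum_edges_le:
  fixes t :: real
  assumes p: "p \<in> partial_inj j" and t: "0 < t" "t < 1"
  shows "(\<Sum>e\<in>p. t ^ (Suc j - max (fst e) (snd e))) \<le> 2 * t / (1 - t)"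
proof -
  have sub: "p \<subseteq> {1..j} \<times> {1..j}" and sv: "single_valued p" "single_valued (p\<inverse>)"
    using p by (auto simp: partial_inj_def)
  have i: "inj_on fst p" "inj_on snd p"
    using sv by (auto simp: inj_on_def single_valued_def)
  have k: "(\<Sum>x=1..j. t ^ (Suc j - x)) = kappa t j"
    unfolding kappa_def
    by (rule sum.reindex_bij_witness[of _ "\<lambda>x. Suc j - x" "\<lambda>x. Suc j - x"]) auto
  have f: "(\<Sum>e\<in>p. t ^ (Suc j - g e)) \<le> kappa t j" if "inj_on g p" "g ` p \<subseteq> {1..j}" for g
  proof -
    have "(\<Sum>e\<in>p. t ^ (Suc j - g e)) = (\<Sum>x\<in>g ` p. t ^ (Suc j - x))"
      by (simp add: sum.reindex[OF that(1)])
    also have "\<dots> \<le> (\<Sum>x=1..j. t ^ (Suc j - x))"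
      by (rule sum_mono2) (use that t in auto)
    finally show ?thesis unfolding k .
  qed
  have "(\<Sum>e\<in>p. t ^ (Suc j - max (fst e) (snd e))) \<le> (\<Sum>e\<in>p. t ^ (Suc j - fst e) + t ^ (Suc j - snd e))"
    using t by (intro sum_mono) (auto simp: max_def)
  also have "\<dots> \<le> kappa t j + kappa t j"
    unfolding sum.distrib by (intro add_mono f i) (use sub in auto)
  finally show ?thesis using kappa_le[OF t, of j] by simp
qed

text \<open>
  The weight of the visible configurations with \<open>m\<close> paths, one of which contains \<open>s\<close>.
\<close>

definition open_level :: "real \<Rightarrow> nat \<Rightarrow> nat \<Rightarrow> nat \<Rightarrow> real" where
  "open_level t j s m = (\<Sum>p | p \<in> partial_inj j \<and> \<not> on_cycle s p \<and> j - card p = m. weight t j p)"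

lemma open_level_nonneg: "0 \<le> t \<Longrightarrow> 0 \<le> open_level t j s m"
  by (simp add: open_level_def sum_nonneg weight_nonneg)

text \<open>
  Double counting.  A configuration with \<open>m + 1\<close> paths admits \<open>(m + 1)\<^sup>2\<close> additional arcs from a head to a
  tail, of which only one closes the cycle of \<open>s\<close>; so at least \<open>m\<^sup>2\<close> are good.  Adding a good arc yields a
  configuration with \<open>m\<close> paths from which the old one is recovered by deleting the arc, and
  \<open>weight_insert\<close> and \<open>sum_edges_le\<close> control the change of the weight.
\<close>

lemma open_level_Suc_le:
  assumes s: "s \<in> {1..j}" and t: "0 < t" "t < 1"
  shows "(real m)\<^sup>2 * open_level t j s (Suc m) \<le> 2 * t / (1 - t) * open_level t j s m"
proof -
  let ?A = "\<lambda>m. {p. p \<in> partial_inj j \<and> \<not> on_cycle s p \<and> j - card p = m}"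
  define G where "G p = {e \<in> heads j p \<times> tails j p. \<not> on_cycle s (insert e p)}" for p
  define h where "h e = t ^ (Suc j - max (fst e) (snd e))" for e
  have fin: "finite (?A m)" for m by (rule finite_subset[OF _ finite_partial_inj[of j]]) auto
  have h0: "0 \<le> h e" for e using t by (simp add: h_def)
  have cG: "(real m)\<^sup>2 \<le> real (card (G p))" if "p \<in> ?A (Suc m)" for p
  proof -
    have p: "p \<in> partial_inj j" and op: "\<not> on_cycle s p" and m: "j - card p = Suc m" using that by auto
    obtain a b where ab: "a \<in> heads j p" "b \<in> tails j p" 
      "\<forall>a'\<in>heads j p. (s, a') \<in> p\<^sup>* \<longleftrightarrow> a' = a"
      "\<forall>b'\<in>tails j p. (b', s) \<in> p\<^sup>* \<longleftrightarrow> b' = b"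
      using unique_closing_pair[OF p s op] by (elim bexE conjE)
    have "G p = heads j p \<times> tails j p - {(a, b)}"
      unfolding G_def using ab op by (auto simp: trancl_insert)
    then have "card (G p) = Suc m * Suc m - 1"
      using ab(1,2) card_heads(1)[OF p] card_tails[OF p] m by (simp add: card_cartesian_product)
    then show ?thesis by (simp add: power2_eq_square algebra_simps)
  qed
  have "(real m)\<^sup>2 * open_level t j s (Suc m) = (\<Sum>p\<in>?A (Suc m). (real m)\<^sup>2 * weight t j p)"
    by (simp add: open_level_def sum_distrib_left)
  also have "\<dots> \<le> (\<Sum>p\<in>?A (Suc m). \<Sum>e\<in>G p. weight t j p)"
    using t by (intro sum_mono) (auto intro!: mult_right_mono cG simp: weight_nonneg)
  also have "\<dots> = (\<Sum>p\<in>?A (Suc m). \<Sum>e\<in>G p. weight t j (insert e p) * h e)"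
  proof (intro sum.cong refl)
    fix p e assume "p \<in> ?A (Suc m)" "e \<in> G p"
    then show "weight t j p = weight t j (insert e p) * h e"
      using weight_insert[of p j "fst e" "snd e" t] by (auto simp: G_def h_def)
  qed
  also have "\<dots> = (\<Sum>(p, e)\<in>Sigma (?A (Suc m)) G. weight t j (insert e p) * h e)"
    by (rule sum.Sigma) (auto simp: fin G_def)
  also have "\<dots> = (\<Sum>(p, e)\<in>(\<lambda>(p, e). (insert e p, e)) ` Sigma (?A (Suc m)) G. weight t j p * h e)"
  proof -
    have "inj_on (\<lambda>(p, e). (insert e p, e)) (Sigma (?A (Suc m)) G)"
    proof (rule inj_onI)
      fix z z' assume "z \<in> Sigma (?A (Suc m)) G" "z' \<in> Sigma (?A (Suc m)) G"
        and eq: "(\<lambda>(p, e). (insert e p, e)) z = (\<lambda>(p, e). (insert e p, e)) z'"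
      then have g: "snd z \<in> G (fst z)" "snd z \<in> G (fst z')" and s: "snd z = snd z'"
        and e: "insert (snd z) (fst z) = insert (snd z) (fst z')"
        by (auto simp: case_prod_unfold)
      have "snd z \<notin> fst z" "snd z \<notin> fst z'" using g by (auto simp: G_def heads_def)
      then have "fst z = fst z'" using e by (metis insert_ident)
      then show "z = z'" using s by (simp add: prod_eq_iff)
    qed
    then show ?thesis by (subst sum.reindex) (auto simp: case_prod_unfold)
  qed
  also have "\<dots> \<le> (\<Sum>(p, e)\<in>Sigma (?A m) (\<lambda>p. p). weight t j p * h e)"
  proof (rule sum_mono2)
    show "finite (Sigma (?A m) (\<lambda>p. p))"
      using fin partial_inj_finite by (intro finite_SigmaI) auto
    show "(\<lambda>(p, e). (insert e p, e)) ` Sigma (?A (Suc m)) G \<subseteq> Sigma (?A m) (\<lambda>p. p)"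
    proof (rule image_subsetI)
      fix z assume "z \<in> Sigma (?A (Suc m)) G"
      then obtain p x y where z: "z = (p, x, y)" and p: "p \<in> partial_inj j" "j - card p = Suc m"
        and g: "(x, y) \<in> G p" by (cases z) auto
      have n: "(x, y) \<notin> p" using g by (auto simp: G_def heads_def)
      have "insert (x, y) p \<in> partial_inj j"
        using p(1) g by (auto simp: G_def partial_inj_def heads_def tails_def single_valued_def)
      moreover have "\<not> on_cycle s (insert (x, y) p)" using g by (simp add: G_def)
      moreover have "j - card (insert (x, y) p) = m" using n p partial_inj_finite[OF p(1)] by simp
      ultimately show "(\<lambda>(p, e). (insert e p, e)) z \<in> Sigma (?A m) (\<lambda>p. p)" by (simp add: z)
    qed
    show "\<And>b. b \<in> Sigma (?A m) (\<lambda>p. p) - (\<lambda>(p, e). (insert e p, e)) ` Sigma (?A (Suc m)) G \<Longrightarrow>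
       0 \<le> (case b of (p, e) \<Rightarrow> weight t j p * h e)"
      using t h0 by (auto simp: weight_nonneg)
  qed
  also have "\<dots> = (\<Sum>p\<in>?A m. \<Sum>e\<in>p. weight t j p * h e)"
    by (rule sum.Sigma[symmetric]) (auto simp: fin intro: partial_inj_finite)
  also have "\<dots> \<le> (\<Sum>p\<in>?A m. weight t j p * (2 * t / (1 - t)))"
    unfolding sum_distrib_left[symmetric]
    using sum_edges_le[OF _ t] t
    by (intro sum_mono mult_left_mono) (auto simp: h_def weight_nonneg)
  also have "\<dots> = 2 * t / (1 - t) * open_level t j s m"
    by (simp add: open_level_def sum_distrib_left mult.commute)
  finally show ?thesis .
qed

lemma sum_by_level:
  fixes F :: "nat \<Rightarrow> real"
  shows "(\<Sum>p\<in>partial_inj j. of_bool (\<not> on_cycle s p) * (weight t j p * F (j - card p)))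
    = (\<Sum>m\<le>j. open_level t j s m * F m)"
proof -
  let ?S = "{p \<in> partial_inj j. \<not> on_cycle s p}"
  have "(\<Sum>p\<in>partial_inj j. of_bool (\<not> on_cycle s p) * (weight t j p * F (j - card p)))
    = (\<Sum>p\<in>?S. weight t j p * F (j - card p))"
    by (rule sum.mono_neutral_cong_right) (auto simp: finite_partial_inj)
  also have "\<dots> = (\<Sum>m\<le>j. \<Sum>p\<in>{p \<in> ?S. j - card p = m}. weight t j p * F (j - card p))"
    by (rule sum.group[symmetric]) (auto simp: finite_partial_inj)
  also have "\<dots> = (\<Sum>m\<le>j. open_level t j s m * F m)"
    unfolding open_level_def sum_distrib_right
    by (rule sum.cong[OF refl], rule sum.cong) auto
  finally show ?thesis .
qed

text \<open>
  Put \<open>V = W * (W + 2)\<close>.  The levels \<open>a m\<close> satisfy \<open>m\<^sup>2 * a (m + 1) \<le> V * a m\<close>, so above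
  a threshold \<open>M\<close> with \<open>M\<^sup>2 \<ge> 2 * V\<close> they at least halve in each step and carry at most
  half of the total.  On the other levels the closing join has conditional probability at least
  \<open>1 / (W + M + 1)\<^sup>2\<close>.  Choosing \<open>M\<close> just above \<open>2 * (W + 1)\<close> gives the constant.
\<close>

lemma open_mass_le_drop:
  assumes s: "s \<in> {1..j}" and j: "j < n" and t: "0 < t" "t < 1"
  defines "W \<equiv> 2 * t / (1 - t)"
  shows "mass t n j (\<lambda>p. of_bool (\<not> on_cycle s p)) \<le> 2 * (3 * W + 4)\<^sup>2 *
    (mass t n j (\<lambda>p. of_bool (\<not> on_cycle s p)) - mass t n (Suc j) (\<lambda>p. of_bool (\<not> on_cycle s p)))"
proof -
  define r where "r = n - Suc j"
  have nj: "n - j = Suc r" using j by (simp add: r_def)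
  have W0: "0 \<le> W" using t by (simp add: W_def)
  have W2: "2 / (1 - t) = W + 2" using t by (simp add: W_def field_simps)
  define M where "M = nat \<lceil>2 * (W + 1)\<rceil>"
  have M: "2 * (W + 1) \<le> real M" "real M \<le> 2 * W + 3"
  proof -
    have "0 \<le> \<lceil>2 * (W + 1)\<rceil>" using W0 by simp
    then have M: "real M = of_int \<lceil>2 * (W + 1)\<rceil>" by (simp only: M_def of_nat_nat)
    show "2 * (W + 1) \<le> real M" unfolding M by (rule le_of_int_ceiling)
    show "real M \<le> 2 * W + 3"
      unfolding M by (rule order_trans[OF of_int_ceiling_le_add_one]) simp
  qed
  define a where "a m = open_level t j s m * completions t (Suc r) m" for m
  define d where "d m = open_level t j s m * (t ^ (m - 1) * completions t r (m - 1))" for m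
  have a0: "0 \<le> a m" and d0: "0 \<le> d m" for m
    using t by (simp_all add: a_def d_def open_level_nonneg completions_nonneg)
  have mass_eq: "mass t n j (\<lambda>p. of_bool (\<not> on_cycle s p)) = (\<Sum>m\<le>j. a m)"
    unfolding mass_def nj a_def by (rule sum_by_level)
  have drop_eq: "mass t n j (\<lambda>p. of_bool (\<not> on_cycle s p)) - mass t n (Suc j) (\<lambda>p. of_bool (\<not> on_cycle s p))
      = (\<Sum>m\<le>j. d m)"
    unfolding open_mass_drop[OF s j] r_def[symmetric] d_def
    by (rule sum_by_level[where F = "\<lambda>m. t ^ (m - 1) * completions t r (m - 1)"])
  \<comment> \<open>The two bounds combine to \<open>V = W * (W + 2)\<close>, as \<open>2 / (1 - t) = W + 2\<close>.\<close>
  have ratio: "(real m)\<^sup>2 * a (Suc m) \<le> W * (W + 2) * a m" for m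
  proof -
    have "(real m)\<^sup>2 * a (Suc m) = ((real m)\<^sup>2 * open_level t j s (Suc m)) * completions t (Suc r) (Suc m)"
      by (simp add: a_def)
    also have "\<dots> \<le> (W * open_level t j s m) * ((W + 2) * completions t (Suc r) m)"
      by (rule mult_mono[OF open_level_Suc_le[OF s t, of m, folded W_def]
            completions_Suc_le[OF t, of "Suc r" m, unfolded W2]])
         (use t W0 in \<open>auto simp del: completions.simps
            intro!: mult_nonneg_nonneg completions_nonneg open_level_nonneg\<close>)
    finally show ?thesis by (simp add: a_def mult_ac del: completions.simps)
  qed
  have half: "a (Suc m) \<le> a m / 2" if "M \<le> m" for m
  proof -
    have m: "2 * (W + 1) \<le> real m" using M that by linarith
    then have "(2 * (W + 1))\<^sup>2 \<le> (real m)\<^sup>2" using W0 by (intro power_mono) auto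
    moreover have "(2 * (W + 1))\<^sup>2 = 2 * (W * (W + 2)) + 2 * W\<^sup>2 + 4 * W + 4"
      by (simp add: power2_eq_square algebra_simps)
    ultimately have m2: "2 * (W * (W + 2)) \<le> (real m)\<^sup>2" using W0 zero_le_power2[of W] by linarith
    have mp: "0 < (real m)\<^sup>2" using m W0 by (auto intro!: zero_less_power)
    have "2 * ((real m)\<^sup>2 * a (Suc m)) \<le> 2 * (W * (W + 2) * a m)" using ratio[of m] by simp
    also have "\<dots> \<le> (real m)\<^sup>2 * a m" using mult_right_mono[OF m2 a0[of m]] by (simp add: mult.assoc)
    finally have "(real m)\<^sup>2 * (2 * a (Suc m)) \<le> (real m)\<^sup>2 * a m" by (simp add: algebra_simps)
    then show ?thesis using mp by simp
  qed
  have small: "of_bool (m \<le> M) * a m \<le> (3 * W + 4)\<^sup>2 * d m" for m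
  proof (cases "m \<le> M")
    case True
    show ?thesis
    proof (cases "m = 0")
      case True
      have "{p. p \<in> partial_inj j \<and> \<not> on_cycle s p \<and> j - card p = 0} = {}"
        using heads_nonempty_if_open[OF _ s] by force
      then have "open_level t j s 0 = 0" unfolding open_level_def by (simp only: sum.empty)
      then show ?thesis using True by (simp add: a_def d_def)
    next
      case False
      then have "completions t (Suc r) m \<le> (W + real m + 1)\<^sup>2 * (t ^ (m - 1) * completions t r (m - 1))"
        using completions_le_close[OF t, of m r] by (simp only: W_def)
      also have "\<dots> \<le> (3 * W + 4)\<^sup>2 * (t ^ (m - 1) * completions t r (m - 1))"
        using W0 M \<open>m \<le> M\<close> t by (intro mult_right_mono power_mono) (auto intro!: mult_nonneg_nonneg completions_nonneg)
      finally have "a m \<le> (3 * W + 4)\<^sup>2 * d m"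
        unfolding a_def d_def using mult_left_mono[OF _ open_level_nonneg[of t j s m]] t
        by (simp add: mult.left_commute)
      then show ?thesis using True by simp
    qed
  next
    case False then show ?thesis using d0[of m] by simp
  qed
  have "(\<Sum>m\<le>j. of_bool (\<not> m \<le> M) * a m) = (\<Sum>m<j. of_bool (\<not> Suc m \<le> M) * a (Suc m))"
    by (simp add: sum.atMost_shift)
  also have "\<dots> \<le> (\<Sum>m<j. a m / 2)"
    using half a0 by (intro sum_mono) auto
  also have "\<dots> \<le> (\<Sum>m\<le>j. a m / 2)"
    using a0 by (intro sum_mono2) auto
  finally have large: "(\<Sum>m\<le>j. of_bool (\<not> m \<le> M) * a m) \<le> (\<Sum>m\<le>j. a m) / 2"
    by (simp add: sum_divide_distrib)
  have "(\<Sum>m\<le>j. a m) = (\<Sum>m\<le>j. of_bool (m \<le> M) * a m) + (\<Sum>m\<le>j. of_bool (\<not> m \<le> M) * a m)"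
    unfolding sum.distrib[symmetric] by (rule sum.cong) auto
  moreover have "(\<Sum>m\<le>j. of_bool (m \<le> M) * a m) \<le> (3 * W + 4)\<^sup>2 * (\<Sum>m\<le>j. d m)"
    unfolding sum_distrib_left by (rule sum_mono) (rule small)
  ultimately have "(\<Sum>m\<le>j. a m) \<le> 2 * (3 * W + 4)\<^sup>2 * (\<Sum>m\<le>j. d m)" using large by linarith
  then show ?thesis unfolding mass_eq[symmetric] drop_eq[symmetric] .
qed

text \<open>
  The sum over time of the drops telescopes and is at most the total mass.
\<close>

lemma sum_open_mass_le:
  assumes s: "s \<in> {1..n}" and t: "0 < t" "t < 1"
  defines "W \<equiv> 2 * t / (1 - t)"
  shows "(\<Sum>j=s..<n. mass t n j (\<lambda>p. of_bool (\<not> on_cycle s p))) \<le> 2 * (3 * W + 4)\<^sup>2 * mass t n 0 (\<lambda>_. 1)"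
proof -
  let ?O = "\<lambda>j. mass t n j (\<lambda>p. of_bool (\<not> on_cycle s p))"
  have "(\<Sum>j=s..<n. ?O j) \<le> (\<Sum>j=s..<n. 2 * (3 * W + 4)\<^sup>2 * (?O j - ?O (Suc j)))"
    unfolding W_def using s t by (intro sum_mono open_mass_le_drop) auto
  also have "\<dots> = 2 * (3 * W + 4)\<^sup>2 * (?O s - ?O n)"
    unfolding sum_distrib_left[symmetric] using s by (subst sum_Suc_diff'[of s n "\<lambda>j. - ?O j", simplified]) auto
  also have "\<dots> \<le> 2 * (3 * W + 4)\<^sup>2 * mass t n 0 (\<lambda>_. 1)"
  proof (rule mult_left_mono)
    have "?O s \<le> mass t n s (\<lambda>_. 1)" using t by (intro mass_mono) auto
    moreover have "0 \<le> ?O n" using t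
      unfolding mass_def by (intro sum_nonneg) (auto simp: weight_nonneg completions_nonneg)
    ultimately show "?O s - ?O n \<le> mass t n 0 (\<lambda>_. 1)" using mass_one[of s n t] s by simp
  qed simp
  finally show ?thesis .
qed

section \<open>Permutations as complete configurations\<close>

definition graph :: "nat \<Rightarrow> (nat \<Rightarrow> nat) \<Rightarrow> (nat \<times> nat) set" where
  "graph n \<sigma> = (\<lambda>i. (i, \<sigma> i)) ` {1..n}"

lemma graph_partial_inj:
  assumes "\<sigma> permutes {1..n}"
  shows "graph n \<sigma> \<in> partial_inj n" "card (graph n \<sigma>) = n"
proof -
  have "\<sigma> i \<in> {1..n}" if "i \<in> {1..n}" for i using permutes_in_image[OF assms, of i] that by simp
  moreover have "inj \<sigma>" using permutes_inj[OF assms] .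
  ultimately show "graph n \<sigma> \<in> partial_inj n"
    by (auto simp: partial_inj_def graph_def single_valued_def dest: injD)
  show "card (graph n \<sigma>) = n"
    unfolding graph_def by (subst card_image) (auto simp: inj_on_def)
qed

lemma bij_betw_graph:
  "bij_betw (graph n) {\<sigma>. \<sigma> permutes {1..n}} {p \<in> partial_inj n. card p = n}"
  unfolding bij_betw_def
proof
  show "inj_on (graph n) {\<sigma>. \<sigma> permutes {1..n}}"
  proof (rule inj_onI, rule ext)
    fix \<sigma> \<tau> i
    assume a: "\<sigma> \<in> {\<sigma>. \<sigma> permutes {1..n}}" "\<tau> \<in> {\<sigma>. \<sigma> permutes {1..n}}" "graph n \<sigma> = graph n \<tau>"
    show "\<sigma> i = \<tau> i"
    proof (cases "i \<in> {1..n}")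
      case True
      then have "(i, \<sigma> i) \<in> graph n \<tau>" unfolding a(3)[symmetric] by (auto simp: graph_def)
      then show ?thesis by (auto simp: graph_def)
    next
      case False
      then show ?thesis using a permutes_not_in by (metis mem_Collect_eq)
    qed
  qed
  show "graph n ` {\<sigma>. \<sigma> permutes {1..n}} = {p \<in> partial_inj n. card p = n}"
  proof
    show "graph n ` {\<sigma>. \<sigma> permutes {1..n}} \<subseteq> {p \<in> partial_inj n. card p = n}"
      using graph_partial_inj by auto
    show "{p \<in> partial_inj n. card p = n} \<subseteq> graph n ` {\<sigma>. \<sigma> permutes {1..n}}"
    proof
      fix p assume "p \<in> {p \<in> partial_inj n. card p = n}"
      then have p: "p \<in> partial_inj n" and c: "card p = n" by auto
      have sub: "p \<subseteq> {1..n} \<times> {1..n}" and sv: "single_valued p" and sv': "single_valued (p\<inverse>)"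
        using p by (auto simp: partial_inj_def)
      have "card (heads n p) = 0" using card_heads(1)[OF p] c by simp
      then have "heads n p = {}" by simp
      then have D: "\<exists>y. (i, y) \<in> p" if "i \<in> {1..n}" for i using that by (auto simp: heads_def)
      define \<sigma> where "\<sigma> i = (if i \<in> {1..n} then (SOME y. (i, y) \<in> p) else i)" for i
      have s: "(i, \<sigma> i) \<in> p" if "i \<in> {1..n}" for i
        using someI_ex[OF D[OF that]] that by (simp add: \<sigma>_def)
      have "inj_on \<sigma> {1..n}"
        by (rule inj_onI) (metis s sv' single_valuedD converseI)
      moreover have "\<sigma> ` {1..n} \<subseteq> {1..n}" using s sub by blast
      ultimately have "bij_betw \<sigma> {1..n} {1..n}"
        by (simp add: bij_betw_def endo_inj_surj)
      moreover have "\<sigma> i = i" if "i \<notin> {1..n}" for i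
        unfolding \<sigma>_def using that by (rule if_not_P)
      ultimately have per: "\<sigma> permutes {1..n}" by (rule bij_imp_permutes)
      have "graph n \<sigma> = p"
      proof (rule card_subset_eq[OF partial_inj_finite[OF p]])
        show "graph n \<sigma> \<subseteq> p" unfolding graph_def using s by blast
        show "card (graph n \<sigma>) = card p" using graph_partial_inj(2)[OF per] c by simp
      qed
      then show "p \<in> graph n ` {\<sigma>. \<sigma> permutes {1..n}}" using per by blast
    qed
  qed
qed

text \<open>
  With \<open>M i = max i (\<sigma> i)\<close>, the distance is the sum of \<open>2 * M i - i - \<sigma> i\<close>, and \<open>\<sigma> i\<close> has the same
  sum as \<open>i\<close>.  On the other side, the arc at \<open>i\<close> is visible at the \<open>n + 1 - M i\<close> times from \<open>M i\<close> on.
\<close>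

lemma weight_graph:
  assumes per: "\<sigma> permutes {1..n}"
  shows "weight (exp (- 2 * \<beta>)) n (graph n \<sigma>) = exp (- \<beta> * L1_dist n \<sigma> id)"
proof -
  let ?t = "exp (- 2 * \<beta>)"
  have rng: "\<sigma> i \<in> {1..n}" if "i \<in> {1..n}" for i using permutes_in_image[OF per, of i] that by simp
  define M where "M i = max i (\<sigma> i)" for i
  have M: "1 \<le> M i \<and> M i \<le> n" if "i \<in> {1..n}" for i using rng[OF that] that by (auto simp: M_def)
  have c: "real (card (restr k (graph n \<sigma>))) = (\<Sum>i=1..n. of_bool (M i \<le> k))" for k
  proof -
    have "restr k (graph n \<sigma>) = (\<lambda>i. (i, \<sigma> i)) ` ({1..n} \<inter> {i. M i \<le> k})"
    proof (rule set_eqI, clarify)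
      fix x y
      show "(x, y) \<in> restr k (graph n \<sigma>) \<longleftrightarrow> (x, y) \<in> (\<lambda>i. (i, \<sigma> i)) ` ({1..n} \<inter> {i. M i \<le> k})"
        using rng[of x] by (auto simp: restr_def graph_def M_def)
    qed
    then have "card (restr k (graph n \<sigma>)) = card ({1..n} \<inter> {i. M i \<le> k})"
      by (simp add: card_image inj_on_def)
    then show ?thesis by (simp add: sum_of_bool_eq)
  qed
  have cnt: "(\<Sum>k=1..n. of_bool (M i \<le> k)) = real n + 1 - real (M i)" if "i \<in> {1..n}" for i
  proof -
    have "(\<Sum>k=1..n. of_bool (M i \<le> k)) = (\<Sum>k\<in>{M i..n}. 1 :: real)"
      by (rule sum.mono_neutral_cong_right) (use M[OF that] in auto)
    then show ?thesis using M[OF that] by simp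
  qed
  have le: "card (restr k (graph n \<sigma>)) \<le> k" for k
    using card_heads(2)[OF restr_partial_inj[OF graph_partial_inj(1)[OF per]]] .
  have "(\<Sum>k=1..m. real k) = real m * (real m + 1) / 2" for m
    by (induction m) (auto simp: field_simps)
  note g = this[of n]
  have "real (\<Sum>k=1..n. k - card (restr k (graph n \<sigma>))) = (\<Sum>k=1..n. real k - (\<Sum>i=1..n. of_bool (M i \<le> k)))"
    using le by (simp add: of_nat_diff c)
  also have "\<dots> = (\<Sum>k=1..n. real k) - (\<Sum>i=1..n. \<Sum>k=1..n. of_bool (M i \<le> k))"
    unfolding sum_subtractf by (subst sum.swap) (rule refl)
  also have "(\<Sum>i=1..n. \<Sum>k=1..n. of_bool (M i \<le> k)) = (\<Sum>i=1..n. real n + 1 - real (M i))"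
    by (rule sum.cong[OF refl cnt])
  also have "\<dots> = real n * (real n + 1) - (\<Sum>i=1..n. real (M i))"
    by (simp add: sum_subtractf)
  finally have A: "real (\<Sum>k=1..n. k - card (restr k (graph n \<sigma>))) = (\<Sum>i=1..n. real (M i)) - real n * (real n + 1) / 2"
    using g by simp
  have "L1_dist n \<sigma> id = (\<Sum>i=1..n. 2 * real (M i) - real i - real (\<sigma> i))"
    unfolding L1_dist_def by (rule sum.cong) (auto simp: M_def max_def)
  also have "\<dots> = 2 * (\<Sum>i=1..n. real (M i)) - (\<Sum>i=1..n. real i) - (\<Sum>i=1..n. real (\<sigma> i))"
    by (simp add: sum_subtractf sum_distrib_left)
  also have "(\<Sum>i=1..n. real (\<sigma> i)) = (\<Sum>i=1..n. real i)"
    using sum.permute[OF per, of real] by (simp add: comp_def)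
  also have "2 * (\<Sum>i=1..n. real (M i)) - (\<Sum>i=1..n. real i) - (\<Sum>i=1..n. real i)
      = 2 * real (\<Sum>k=1..n. k - card (restr k (graph n \<sigma>)))"
    unfolding A g by (simp add: field_simps)
  finally have L: "L1_dist n \<sigma> id = 2 * real (\<Sum>k=1..n. k - card (restr k (graph n \<sigma>)))"
    .
  have "weight ?t n (graph n \<sigma>) = ?t ^ (\<Sum>k=1..n. k - card (restr k (graph n \<sigma>)))"
    unfolding weight_def by (rule power_sum[symmetric])
  also have "\<dots> = exp (- \<beta> * L1_dist n \<sigma> id)"
    unfolding L by (simp add: exp_of_nat_mult[symmetric] mult_ac)
  finally show ?thesis .
qed

definition wsum :: "nat \<Rightarrow> real \<Rightarrow> ((nat \<Rightarrow> nat) \<Rightarrow> real) \<Rightarrow> real" where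
  "wsum n \<beta> F = (\<Sum>\<sigma> | \<sigma> permutes {1..n}. F \<sigma> * exp (- \<beta> * L1_dist n \<sigma> id))"

text \<open>
  At time \<open>n\<close> the factor \<open>completions t 0\<close> selects the configurations without missing arcs, which are
  the graphs of the permutations.
\<close>

lemma mass_top:
  "mass (exp (- 2 * \<beta>)) n n f = wsum n \<beta> (\<lambda>\<sigma>. f (graph n \<sigma>))"
proof -
  let ?t = "exp (- 2 * \<beta>)"
  have "mass ?t n n f = (\<Sum>p | p \<in> partial_inj n \<and> card p = n. f p * weight ?t n p)"
    unfolding mass_def
    by (rule sum.mono_neutral_cong_right) (use card_heads(2) in \<open>force simp: finite_partial_inj\<close>)+
  also have "\<dots> = (\<Sum>\<sigma> | \<sigma> permutes {1..n}. f (graph n \<sigma>) * weight ?t n (graph n \<sigma>))"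
    by (rule sum.reindex_bij_betw[OF bij_betw_graph, symmetric])
  also have "\<dots> = wsum n \<beta> (\<lambda>\<sigma>. f (graph n \<sigma>))"
    unfolding wsum_def by (rule sum.cong[OF refl]) (simp only: weight_graph mem_Collect_eq)
  finally show ?thesis .
qed

lemma wsum_one: "wsum n \<beta> (\<lambda>_. 1) = mallows_Z n \<beta>"
  by (simp add: wsum_def mallows_Z_def)

lemma wsum_mono:
  "(\<And>\<sigma>. \<sigma> permutes {1..n} \<Longrightarrow> F \<sigma> \<le> G \<sigma>) \<Longrightarrow> wsum n \<beta> F \<le> wsum n \<beta> G"
  unfolding wsum_def by (intro sum_mono mult_right_mono) auto

lemma wsum_cong:
  "(\<And>\<sigma>. \<sigma> permutes {1..n} \<Longrightarrow> F \<sigma> = G \<sigma>) \<Longrightarrow> wsum n \<beta> F = wsum n \<beta> G"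
  unfolding wsum_def by (intro sum.cong) auto

lemma wsum_add: "wsum n \<beta> (\<lambda>\<sigma>. F \<sigma> + G \<sigma>) = wsum n \<beta> F + wsum n \<beta> G"
  by (simp add: wsum_def distrib_right sum.distrib)

lemma wsum_sum: "wsum n \<beta> (\<lambda>\<sigma>. \<Sum>v\<in>A. F v \<sigma>) = (\<Sum>v\<in>A. wsum n \<beta> (F v))"
  unfolding wsum_def by (simp add: sum_distrib_right) (rule sum.swap)

lemma expectation_wsum:
  "measure_pmf.expectation (mallows_pmf n \<beta>) F = wsum n \<beta> F / mallows_Z n \<beta>"
proof -
  have "measure_pmf.expectation (mallows_pmf n \<beta>) F
     = (\<Sum>\<sigma> | \<sigma> permutes {1..n}. F \<sigma> * pmf (mallows_pmf n \<beta>) \<sigma>)"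
    by (rule integral_measure_pmf_real) (auto simp: set_pmf_mallows finite_permutations)
  also have "\<dots> = wsum n \<beta> F / mallows_Z n \<beta>"
    by (simp add: wsum_def pmf_mallows sum_divide_distrib)
  finally show ?thesis .
qed

text \<open>
  What was visible at time \<open>j\<close> does not change when more points are revealed.
\<close>

lemma mass_restr:
  assumes "j \<le> i" "i \<le> n"
  shows "mass t n i (\<lambda>p. f (restr j p)) = mass t n j f"
  using assms
proof (induction i rule: dec_induct)
  case base
  show ?case unfolding mass_def by (rule sum.cong) (auto simp: restr_id)
next
  case (step i)
  have i: "i < n" and ni: "n - i = Suc (n - Suc i)" using step by auto
  have r: "restr j (insert (x, Suc i) q) = restr j q" "restr j (insert (Suc i, x) q) = restr j q" for x q
    using step by (auto simp: restr_def)
  have "extension_sum t (n - Suc i) i (\<lambda>p. f (restr j p)) p = f (restr j p) * completions t (Suc (n - Suc i)) (i - card p)"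
    if "p \<in> partial_inj i" for p
    unfolding extension_sum_const[OF that, symmetric] unfolding extension_sum_def Let_def r ..
  then have "mass t n (Suc i) (\<lambda>p. f (restr j p)) = mass t n i (\<lambda>p. f (restr j p))"
    unfolding mass_Suc[OF i] mass_def[of t n i] ni
    by (intro sum.cong) (simp_all only: mult.left_commute)
  then show ?case using step by simp
qed

lemma trancl_graph_iff_orbit:
  assumes per: "\<sigma> permutes {1..n}" and s: "s \<in> {1..n}"
  shows "(s, v) \<in> (graph n \<sigma>)\<^sup>+ \<longleftrightarrow> v \<in> orbit \<sigma> s"
proof
  assume "(s, v) \<in> (graph n \<sigma>)\<^sup>+"
  then show "v \<in> orbit \<sigma> s"
    by (induction rule: trancl_induct) (auto simp: graph_def intro: orbit.intros)
next
  assume "v \<in> orbit \<sigma> s"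
  then show "(s, v) \<in> (graph n \<sigma>)\<^sup>+"
  proof induction
    case base
    have "(s, \<sigma> s) \<in> graph n \<sigma>" using s by (auto simp: graph_def)
    then show ?case by blast
  next
    case (step y)
    have "y \<in> {1..n}" using permutes_orbit_subset[OF per s] step by blast
    then have "(y, \<sigma> y) \<in> graph n \<sigma>" by (auto simp: graph_def)
    then show ?case using step by (meson trancl_into_trancl)
  qed
qed

lemma linked_graph:
  assumes per: "\<sigma> permutes {1..n}" and s: "s \<in> {1..n}" and v: "v \<in> {1..n}"
    and l: "linked s v (graph n \<sigma>)"
  shows "v \<in> cycle_of s \<sigma>"
proof -
  have "permutation \<sigma>" using per by (auto simp: permutation_permutes)
  then have self: "s \<in> orbit \<sigma> s" "v \<in> orbit \<sigma> v" by (auto intro: permutation_self_in_orbit)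
  have "v \<in> orbit \<sigma> s \<or> s \<in> orbit \<sigma> v"
    using l self trancl_graph_iff_orbit[OF per s] trancl_graph_iff_orbit[OF per v]
    unfolding linked_def by (metis rtranclD)
  then show ?thesis unfolding cycle_of_def using orbit_swap[OF self(2)] by blast
qed

text \<open>
  A cycle that is already visible at time \<open>j\<close> is the whole cycle of \<open>s\<close> and lies in \<open>{1..j}\<close>.
\<close>

lemma not_on_cycle_before_later_point:
  assumes per: "\<sigma> permutes {1..n}" and v: "v \<in> cycle_of s \<sigma>" "j < v"
  shows "\<not> on_cycle s (restr j (graph n \<sigma>))"
proof
  assume c: "on_cycle s (restr j (graph n \<sigma>))"
  have "\<exists>k>0. y = (\<sigma> ^^ k) s \<and> (\<forall>i\<le>k. (\<sigma> ^^ i) s \<le> j)" if "(s, y) \<in> (restr j (graph n \<sigma>))\<^sup>+" for y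
    using that
  proof (induction rule: trancl_induct)
    case (base y)
    then have "y = \<sigma> s" "s \<le> j" "\<sigma> s \<le> j" by (auto simp: restr_def graph_def)
    then show ?case by (intro exI[of _ 1]) (auto simp: le_Suc_eq)
  next
    case (step y z)
    then obtain k where k: "k > 0" "y = (\<sigma> ^^ k) s" "\<forall>i\<le>k. (\<sigma> ^^ i) s \<le> j" by blast
    have "z = \<sigma> y" "z \<le> j" using step by (auto simp: restr_def graph_def)
    then show ?case using k by (intro exI[of _ "Suc k"]) (auto simp: le_Suc_eq)
  qed
  from this[OF c] obtain k where k: "k > 0" "(\<sigma> ^^ k) s = s" "\<forall>i\<le>k. (\<sigma> ^^ i) s \<le> j" by metis
  have "orbit \<sigma> s = {(\<sigma> ^^ m) s | m. m < k}" by (rule orbit_altdef_bounded[OF k(2,1)])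
  then obtain m where "v = (\<sigma> ^^ m) s" "m < k" using v(1) by (auto simp: cycle_of_def)
  then show False using v(2) k(3) by (meson leD less_imp_le)
qed

definition later_points :: "nat \<Rightarrow> (nat \<Rightarrow> nat) \<Rightarrow> nat set" where
  "later_points s \<sigma> = {v \<in> cycle_of s \<sigma>. s < v}"

lemma card_later_points:
  assumes "\<sigma> permutes {1..n}" "s \<in> {1..n}"
  shows "real (card (later_points s \<sigma>)) = (\<Sum>v\<in>{s<..n}. of_bool (v \<in> cycle_of s \<sigma>))"
proof -
  have "later_points s \<sigma> = {s<..n} \<inter> {v. v \<in> cycle_of s \<sigma>}"
    using permutes_orbit_subset[OF assms] by (auto simp: later_points_def cycle_of_def)
  then show ?thesis by (simp add: sum_of_bool_eq)
qed

section \<open>Reflection\<close>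

definition flip :: "nat \<Rightarrow> nat \<Rightarrow> nat" where
  "flip n i = (if i \<in> {1..n} then Suc n - i else i)"

lemma flip_flip: "flip n (flip n i) = i" and flip_in: "i \<in> {1..n} \<Longrightarrow> flip n i \<in> {1..n}"
  by (auto simp: flip_def)

lemma flip_permutes: "flip n permutes {1..n}"
  by (rule bij_imp_permutes)
     (rule bij_betw_byWitness[where f' = "flip n"], auto simp: flip_def)

lemma conj_flip_permutes:
  "\<sigma> permutes {1..n} \<Longrightarrow> (flip n \<circ> \<sigma> \<circ> flip n) permutes {1..n}"
  by (intro permutes_compose flip_permutes)

lemma L1_dist_flip:
  assumes per: "\<sigma> permutes {1..n}"
  shows "L1_dist n (flip n \<circ> \<sigma> \<circ> flip n) id = L1_dist n \<sigma> id"
proof -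
  have "L1_dist n (flip n \<circ> \<sigma> \<circ> flip n) id = (\<Sum>j\<in>{1..n}. \<bar>real (flip n (\<sigma> (flip n j))) - real (flip n (flip n j))\<bar>)"
    by (simp add: L1_dist_def flip_flip)
  also have "\<dots> = (\<Sum>j\<in>{1..n}. \<bar>real (flip n (\<sigma> j)) - real (flip n j)\<bar>)"
    using sum.permute[OF flip_permutes, of "\<lambda>j. \<bar>real (flip n (\<sigma> j)) - real (flip n j)\<bar>"] by (simp add: comp_def)
  also have "\<dots> = L1_dist n \<sigma> id"
    unfolding L1_dist_def
  proof (rule sum.cong[OF refl])
    fix j assume j: "j \<in> {1..n}"
    then have "\<sigma> j \<in> {1..n}" using permutes_in_image[OF per] by blast
    then show "\<bar>real (flip n (\<sigma> j)) - real (flip n j)\<bar> = \<bar>real (\<sigma> j) - real (id j)\<bar>"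
      using j by (auto simp: flip_def of_nat_diff)
  qed
  finally show ?thesis .
qed

lemma wsum_flip:
  "wsum n \<beta> (\<lambda>\<sigma>. F (flip n \<circ> \<sigma> \<circ> flip n)) = wsum n \<beta> F"
proof -
  have conj_conj: "flip n \<circ> (flip n \<circ> \<sigma> \<circ> flip n) \<circ> flip n = \<sigma>" for \<sigma>
    by (simp add: fun_eq_iff flip_flip)
  show ?thesis
    unfolding wsum_def
    by (rule sum.reindex_bij_witness[of _ "\<lambda>\<sigma>. flip n \<circ> \<sigma> \<circ> flip n" "\<lambda>\<sigma>. flip n \<circ> \<sigma> \<circ> flip n"])
       (simp_all only: mem_Collect_eq conj_flip_permutes L1_dist_flip conj_conj)
qed

lemma cycle_of_flip:
  assumes "\<sigma> permutes {1..n}"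
  shows "cycle_of (flip n s) (flip n \<circ> \<sigma> \<circ> flip n) = flip n ` cycle_of s \<sigma>"
  unfolding cycle_of_def
  by (rule orbit_inverse[symmetric]) (use self_in_cycle_of[OF assms] in \<open>auto simp: cycle_of_def flip_flip\<close>)

text \<open>
  Reflection turns the points of the cycle before \<open>s\<close> into the points after \<open>flip n s\<close>.
\<close>

lemma card_cycle_of:
  assumes per: "\<sigma> permutes {1..n}" and s: "s \<in> {1..n}"
  shows "card (cycle_of s \<sigma>) = card (later_points s \<sigma>) + 1
     + card (later_points (flip n s) (flip n \<circ> \<sigma> \<circ> flip n))"
proof -
  have sub: "cycle_of s \<sigma> \<subseteq> {1..n}" using permutes_orbit_subset[OF per s] by (simp add: cycle_of_def)
  then have fin: "finite (cycle_of s \<sigma>)" using finite_subset by blast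
  have inj: "inj (flip n)" by (rule inj_on_inverseI[of _ "flip n"]) (simp add: flip_flip)
  have lt: "flip n s < flip n v \<longleftrightarrow> v < s" if "v \<in> {1..n}" for v
    using that s by (auto simp: flip_def)
  have "later_points (flip n s) (flip n \<circ> \<sigma> \<circ> flip n) = flip n ` {v \<in> cycle_of s \<sigma>. v < s}"
    unfolding later_points_def cycle_of_flip[OF per] using lt sub by auto
  then have c: "card (later_points (flip n s) (flip n \<circ> \<sigma> \<circ> flip n)) = card {v \<in> cycle_of s \<sigma>. v < s}"
    using inj by (metis card_image inj_on_subset subset_UNIV)
  have "cycle_of s \<sigma> = later_points s \<sigma> \<union> ({s} \<union> {v \<in> cycle_of s \<sigma>. v < s})"
    using self_in_cycle_of[OF per] by (auto simp: later_points_def)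
  moreover have "card (later_points s \<sigma> \<union> ({s} \<union> {v \<in> cycle_of s \<sigma>. v < s})) =
     card (later_points s \<sigma>) + (1 + card {v \<in> cycle_of s \<sigma>. v < s})"
    using fin by (subst card_Un_disjoint; (subst card_Un_disjoint)?) (auto simp: later_points_def)
  ultimately show ?thesis using c by simp
qed

lemma wsum_card_cycle_of:
  assumes "s \<in> {1..n}"
  shows "wsum n \<beta> (\<lambda>\<sigma>. real (card (cycle_of s \<sigma>))) =
    wsum n \<beta> (\<lambda>\<sigma>. real (card (later_points s \<sigma>))) + mallows_Z n \<beta>
     + wsum n \<beta> (\<lambda>\<sigma>. real (card (later_points (flip n s) \<sigma>)))"
proof -
  have "wsum n \<beta> (\<lambda>\<sigma>. real (card (cycle_of s \<sigma>))) = wsum n \<beta> (\<lambda>\<sigma>. real (card (later_points s \<sigma>)) + 1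
     + real (card (later_points (flip n s) (flip n \<circ> \<sigma> \<circ> flip n))))"
    by (rule wsum_cong) (simp only: card_cycle_of[OF _ assms] of_nat_add of_nat_1)
  also have "\<dots> = wsum n \<beta> (\<lambda>\<sigma>. real (card (later_points s \<sigma>))) + mallows_Z n \<beta>
     + wsum n \<beta> (\<lambda>\<sigma>. real (card (later_points (flip n s) \<sigma>)))"
    unfolding wsum_add wsum_one using wsum_flip[of n \<beta> "\<lambda>\<sigma>. real (card (later_points (flip n s) \<sigma>))"] by simp
  finally show ?thesis .
qed

section \<open>The bounds on the expected cycle length\<close>

lemma width_le:
  assumes "\<beta> > 0"
  shows "2 * exp (- 2 * \<beta>) / (1 - exp (- 2 * \<beta>)) \<le> 1 / (\<beta>::real)"
proof -
  let ?t = "exp (- 2 * \<beta>)"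
  have t: "0 < ?t" "?t < 1" using assms by auto
  have "?t * (1 + 2 * \<beta>) \<le> ?t * exp (2 * \<beta>)"
    using exp_ge_add_one_self[of "2 * \<beta>"] by (intro mult_left_mono) auto
  also have "\<dots> = 1" by (simp add: exp_add[symmetric])
  finally have "2 * ?t * \<beta> \<le> 1 - ?t" by (simp add: algebra_simps)
  then show ?thesis using t assms by (simp add: field_simps)
qed

text \<open>
  A later point \<open>v\<close> of the cycle forces \<open>s\<close> to be on a path at time \<open>v - 1\<close>, so \<open>sum_open_mass_le\<close>
  applies with \<open>W \<le> 1 / \<beta>\<close>; the number 98 is twice the square of seven, from \<open>3 * W + 4 \<le> 7 * max (1 / \<beta>) 1\<close>.
\<close>

lemma wsum_later_points_le:
  assumes s: "s \<in> {1..n}" and \<beta>: "\<beta> > 0"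
  shows "wsum n \<beta> (\<lambda>\<sigma>. real (card (later_points s \<sigma>))) \<le> 98 * max (1 / \<beta>\<^sup>2) 1 * mallows_Z n \<beta>"
proof -
  define t where "t = exp (- 2 * \<beta>)"
  have t: "0 < t" "t < 1" using \<beta> by (auto simp: t_def)
  define W where "W = 2 * t / (1 - t)"
  have W: "0 \<le> W" "W \<le> 1 / \<beta>" using t width_le[OF \<beta>] by (simp_all add: W_def t_def)
  have Z: "mass t n 0 (\<lambda>_. 1) = mallows_Z n \<beta>"
    using mass_one[of n n t] mass_top[of \<beta> n "\<lambda>_. 1"] by (simp add: t_def wsum_one)
  have v: "wsum n \<beta> (\<lambda>\<sigma>. of_bool (v \<in> cycle_of s \<sigma>)) \<le> mass t n (v - 1) (\<lambda>p. of_bool (\<not> on_cycle s p))"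
    if "v \<in> {s<..n}" for v
  proof -
    have "wsum n \<beta> (\<lambda>\<sigma>. of_bool (v \<in> cycle_of s \<sigma>))
        \<le> wsum n \<beta> (\<lambda>\<sigma>. of_bool (\<not> on_cycle s (restr (v - 1) (graph n \<sigma>))))"
      using not_on_cycle_before_later_point[of _ n v s "v - 1"] that by (intro wsum_mono) auto
    also have "\<dots> = mass t n n (\<lambda>p. of_bool (\<not> on_cycle s (restr (v - 1) p)))"
      unfolding t_def by (rule mass_top[symmetric])
    also have "\<dots> = mass t n (v - 1) (\<lambda>p. of_bool (\<not> on_cycle s p))"
      by (rule mass_restr) (use that in auto)
    finally show ?thesis .
  qed
  have "wsum n \<beta> (\<lambda>\<sigma>. real (card (later_points s \<sigma>)))
     = (\<Sum>v\<in>{s<..n}. wsum n \<beta> (\<lambda>\<sigma>. of_bool (v \<in> cycle_of s \<sigma>)))"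
    unfolding wsum_sum[symmetric] by (rule wsum_cong) (rule card_later_points[OF _ s])
  also have "\<dots> \<le> (\<Sum>v\<in>{s<..n}. mass t n (v - 1) (\<lambda>p. of_bool (\<not> on_cycle s p)))"
    by (rule sum_mono) (rule v)
  also have "\<dots> = (\<Sum>j=s..<n. mass t n j (\<lambda>p. of_bool (\<not> on_cycle s p)))"
    by (rule sum.reindex_bij_witness[of _ Suc "\<lambda>v. v - 1"]) auto
  also have "\<dots> \<le> 2 * (3 * W + 4)\<^sup>2 * mallows_Z n \<beta>"
    using sum_open_mass_le[OF s t] Z by (simp add: W_def)
  also have "\<dots> \<le> 98 * max (1 / \<beta>\<^sup>2) 1 * mallows_Z n \<beta>"
  proof (rule mult_right_mono)
    define M where "M = max (1 / \<beta>) 1"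
    have "3 * W + 4 \<le> 7 * M" using W by (auto simp: M_def)
    then have "(3 * W + 4)\<^sup>2 \<le> (7 * M)\<^sup>2" using W by (intro power_mono) auto
    moreover have "M\<^sup>2 = max (1 / \<beta>\<^sup>2) 1"
    proof (cases "\<beta> \<le> 1")
      case True
      then have "\<beta>\<^sup>2 \<le> 1" using \<beta> by (simp add: power_le_one)
      then show ?thesis using True \<beta> by (simp add: M_def max_def power_divide)
    next
      case False
      then have "1 \<le> \<beta>\<^sup>2" by (simp add: one_le_power)
      then show ?thesis using False \<beta> by (auto simp: M_def max_def divide_simps)
    qed
    ultimately show "2 * (3 * W + 4)\<^sup>2 \<le> 98 * max (1 / \<beta>\<^sup>2) 1" by (simp add: power_mult_distrib)
  qed (use mallows_Z_pos[of n \<beta>] in simp)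
  finally show ?thesis .
qed

text \<open>
  The first step costs \<open>1 / \<kappa>\<close> and every later one \<open>1 / \<kappa>\<^sup>2\<close>, up to the factor \<open>t\<^sup>2\<close>.  One value of \<open>\<kappa>\<close>
  serves all times up to \<open>k\<close> because \<open>kappa\<close> grows with the number of points still to come.
\<close>

lemma on_cycle_mass_le:
  assumes i: "i \<in> {1..n}" and t: "0 < t" "t \<le> 1" and \<kappa>: "0 \<le> \<kappa>" "\<kappa> \<le> kappa t (n - k)"
    and j: "i \<le> j" "j \<le> k" "k \<le> n"
  shows "t\<^sup>2 * \<kappa>\<^sup>2 * mass t n j (\<lambda>p. of_bool (on_cycle i p)) \<le> (\<kappa> + real (j - i)) * mass t n 0 (\<lambda>_. 1)"
  using j(1,2)
proof (induction j rule: dec_induct)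
  case base
  have "\<kappa> \<le> kappa t (n - i)" using \<kappa>(2) kappa_mono[OF _ diff_le_mono2[OF base(1)], of t n] t by linarith
  moreover have nn: "0 \<le> mass t n i (\<lambda>p. of_bool (on_cycle i p))" using t
    unfolding mass_def by (intro sum_nonneg) (auto simp: weight_nonneg completions_nonneg)
  ultimately have "t\<^sup>2 * \<kappa> * mass t n i (\<lambda>p. of_bool (on_cycle i p)) \<le> t\<^sup>2 * kappa t (n - i) * mass t n i (\<lambda>p. of_bool (on_cycle i p))"
    using t by (intro mult_right_mono mult_left_mono) auto
  also have "\<dots> \<le> mass t n 0 (\<lambda>_. 1)" by (rule on_cycle_mass_start[OF i t])
  finally have "\<kappa> * (t\<^sup>2 * \<kappa> * mass t n i (\<lambda>p. of_bool (on_cycle i p))) \<le> \<kappa> * mass t n 0 (\<lambda>_. 1)"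
    using \<kappa> by (intro mult_left_mono) auto
  then show ?case by (simp add: power2_eq_square mult_ac)
next
  case (step j)
  let ?O = "\<lambda>j. mass t n j (\<lambda>p. of_bool (\<not> on_cycle i p))"
  let ?C = "\<lambda>j. mass t n j (\<lambda>p. of_bool (on_cycle i p))"
  let ?Z = "mass t n 0 (\<lambda>_. 1)"
  have jn: "j < n" and ij: "i \<in> {1..j}" using step j i by auto
  have OC: "?O l + ?C l = ?Z" if "l \<le> n" for l
  proof -
    have "?O l + ?C l = mass t n l (\<lambda>_. 1)"
      unfolding mass_add[symmetric] by (rule arg_cong[where f = "mass t n l"]) auto
    then show ?thesis using mass_one[OF that] by simp
  qed
  have nn: "0 \<le> ?C l" for l using t
    unfolding mass_def by (intro sum_nonneg) (auto simp: weight_nonneg completions_nonneg)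
  have drop: "0 \<le> ?O j - ?O (Suc j)"
    unfolding open_mass_drop[OF ij jn] using t
    by (intro sum_nonneg) (auto simp: weight_nonneg completions_nonneg)
  have "\<kappa> \<le> kappa t (n - Suc j)" using \<kappa>(2) kappa_mono[of t "n - k" "n - Suc j", OF _ diff_le_mono2] t step by simp
  then have "t\<^sup>2 * \<kappa>\<^sup>2 * (?O j - ?O (Suc j)) \<le> t\<^sup>2 * (kappa t (n - Suc j))\<^sup>2 * (?O j - ?O (Suc j))"
    using drop \<kappa> by (intro mult_right_mono mult_left_mono power_mono) auto
  also have "\<dots> \<le> ?O j" by (rule open_mass_drop_le[OF ij jn t])
  also have "\<dots> \<le> ?Z" using OC[of j] nn[of j] jn by linarith
  finally have d: "t\<^sup>2 * \<kappa>\<^sup>2 * (?O j - ?O (Suc j)) \<le> ?Z" .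
  have "?C (Suc j) = ?C j + (?O j - ?O (Suc j))" using OC[of j] OC[of "Suc j"] jn by linarith
  then have "t\<^sup>2 * \<kappa>\<^sup>2 * ?C (Suc j) = t\<^sup>2 * \<kappa>\<^sup>2 * ?C j + t\<^sup>2 * \<kappa>\<^sup>2 * (?O j - ?O (Suc j))"
    by (simp add: distrib_left)
  also have "\<dots> \<le> (\<kappa> + real (j - i)) * ?Z + ?Z" using step d by (intro add_mono) auto
  also have "\<dots> = (\<kappa> + real (Suc j - i)) * ?Z" using step by (simp add: Suc_diff_le algebra_simps)
  finally show ?case .
qed

text \<open>
  For \<open>i \<le> 1 / \<beta>\<close> the summand \<open>exp (- 2 * \<beta> * i)\<close> is at least \<open>exp (- 2) \<ge> 1 / 9\<close>.
\<close>

lemma kappa_ge: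
  assumes "0 < \<beta>" "real q \<le> 1 / \<beta>" "q \<le> r"
  shows "real q / 9 \<le> kappa (exp (- 2 * \<beta>)) r"
proof -
  have e9: "(1::real) / 9 \<le> exp (- 2)"
  proof -
    have "exp (2::real) = exp 1 * exp 1" by (simp add: exp_add[symmetric])
    also have "\<dots> \<le> 3 * 3" by (intro mult_mono exp_le) auto
    finally show ?thesis by (simp add: exp_minus field_simps)
  qed
  have "real q / 9 = (\<Sum>i=1..q. 1 / 9)" by simp
  also have "\<dots> \<le> kappa (exp (- 2 * \<beta>)) q"
    unfolding kappa_def
  proof (rule sum_mono)
    fix i assume "i \<in> {1..q}"
    then have "real i * \<beta> \<le> 1" using assms(1,2)
      by (meson atLeastAtMost_iff of_nat_le_iff order_trans pos_le_divide_eq)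
    then have "exp (- 2) \<le> exp (real i * (- 2 * \<beta>))" by simp
    also have "\<dots> = exp (- 2 * \<beta>) ^ i" by (rule exp_of_nat_mult)
    finally show "1 / 9 \<le> exp (- 2 * \<beta>) ^ i" using e9 by linarith
  qed
  also have "\<dots> \<le> kappa (exp (- 2 * \<beta>)) r" using assms by (intro kappa_mono) auto
  finally show ?thesis .
qed

text \<open>
  Write \<open>y = sqrt x\<close>.  Up to time \<open>k = s + L\<close> with \<open>L\<close> about \<open>x / 209952\<close> there remain at least \<open>n / 4 \<ge> y\<close>
  points, so that \<open>kappa\<close> is at least \<open>y / 18\<close>, and \<open>t\<^sup>2 \<ge> 1 / 81\<close> because \<open>\<beta> \<le> 1\<close>.
  A point of \<open>{s..k}\<close> is therefore on a cycle at time \<open>k\<close> with probability at most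
  \<open>81 * (18 / y + 324 * L / y\<^sup>2) \<le> 1 / 4\<close>; the two terms are at most one eighth each since
  \<open>11664 = 8 * 81 * 18\<close> and \<open>209952 = 8 * 81 * 324\<close>.  By \<open>mass_linked_ge\<close> each of the \<open>L\<close> points
  after \<open>s\<close> is then in the cycle of \<open>s\<close> with probability at least one quarter.
\<close>

lemma wsum_later_points_ge:
  assumes \<beta>: "\<beta> > 0" and s: "s \<in> {1..n}" and half: "2 * s \<le> n + 1"
    and x: "x = min (1 / \<beta>\<^sup>2) (real n)" and large: "11664\<^sup>2 \<le> x"
  shows "x / 1679616 * mallows_Z n \<beta> \<le> wsum n \<beta> (\<lambda>\<sigma>. real (card (later_points s \<sigma>)))"
proof -
  define t where "t = exp (- 2 * \<beta>)"
  define Z where "Z = mallows_Z n \<beta>"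
  have Z0: "0 < Z" by (simp add: Z_def mallows_Z_pos)
  have Z: "mass t n 0 (\<lambda>_. 1) = Z"
    using mass_one[of n n t] mass_top[of \<beta> n "\<lambda>_. 1"] by (simp add: t_def wsum_one Z_def)
  define y where "y = sqrt x"
  have x0: "0 < x" using large by simp
  have yy: "y * y = x" and y0: "0 < y" using x0 by (simp_all add: y_def)
  have y: "11664 \<le> y" unfolding y_def by (rule real_le_rsqrt) (use large in simp)
  have xb: "x \<le> 1 / \<beta>\<^sup>2" and xn: "x \<le> real n" using x by auto
  have yb: "y \<le> 1 / \<beta>"
  proof -
    have "y \<le> sqrt (1 / \<beta>\<^sup>2)" unfolding y_def using xb by simp
    then show ?thesis using \<beta> by (simp add: real_sqrt_divide)
  qed
  have "1 \<le> 1 / \<beta>" using y yb by linarith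
  then have b1: "\<beta> \<le> 1" using \<beta> by (simp add: field_simps)
  have t: "0 < t" "t \<le> 1" using \<beta> by (auto simp: t_def)
  have t2: "1 / 81 \<le> t\<^sup>2"
  proof -
    have "exp (4::real) = exp 1 * exp 1 * (exp 1 * exp 1)" by (simp add: exp_add[symmetric])
    also have "\<dots> \<le> 3 * 3 * (3 * 3)" by (intro mult_mono exp_le) auto
    finally have "1 / 81 \<le> exp (- 4 :: real)" by (simp add: exp_minus field_simps)
    also have "\<dots> \<le> exp (- 2 * \<beta> + - 2 * \<beta>)" using b1 by simp
    also have "\<dots> = t\<^sup>2" unfolding t_def power2_eq_square by (rule exp_add)
    finally show ?thesis .
  qed
  define L where "L = nat \<lfloor>x / 209952\<rfloor>"
  have L: "real L \<le> x / 209952" "x / 209952 - 1 \<le> real L"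
  proof -
    have "0 \<le> \<lfloor>x / 209952\<rfloor>" using x0 by simp
    then have e: "real L = of_int \<lfloor>x / 209952\<rfloor>" by (simp add: L_def)
    show "real L \<le> x / 209952" unfolding e by (rule of_int_floor_le)
    show "x / 209952 - 1 \<le> real L" unfolding e using floor_correct[of "x / 209952"] by linarith
  qed
  define k where "k = s + L"
  have half': "2 * real s \<le> real n + 1" using half by linarith
  have nk: "real n / 4 \<le> real n - real k"
    using L(1) xn half' large unfolding k_def by simp
  have kn: "k \<le> n" using nk by simp
  define q where "q = nat \<lfloor>y\<rfloor>"
  have q: "real q \<le> y" "y - 1 \<le> real q"
  proof -
    have "0 \<le> \<lfloor>y\<rfloor>" using y0 by simp
    then have e: "real q = of_int \<lfloor>y\<rfloor>" by (simp add: q_def)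
    show "real q \<le> y" unfolding e by (rule of_int_floor_le)
    show "y - 1 \<le> real q" unfolding e using floor_correct[of "y"] by linarith
  qed
  have "4 * y \<le> y * y" using y by (intro mult_right_mono) auto
  then have "4 * y \<le> real n" using yy xn by linarith
  then have "real q \<le> real n - real k" using nk q(1) by linarith
  then have qn: "q \<le> n - k" using kn by linarith
  define \<kappa> where "\<kappa> = y / 18"
  have \<kappa>0: "0 < \<kappa>" using y0 by (simp add: \<kappa>_def)
  have "real q / 9 \<le> kappa t (n - k)"
    unfolding t_def by (rule kappa_ge[OF \<beta> _ qn]) (use q yb in linarith)
  then have \<kappa>: "\<kappa> \<le> kappa t (n - k)" using q(2) y unfolding \<kappa>_def by linarith
  have on_cycle_le: "mass t n k (\<lambda>p. of_bool (on_cycle i p)) \<le> Z / 4" if i: "s \<le> i" "i \<le> k" for i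
  proof -
    let ?C = "mass t n k (\<lambda>p. of_bool (on_cycle i p))"
    have nn: "0 \<le> ?C" using t
      unfolding mass_def by (intro sum_nonneg) (auto simp: weight_nonneg completions_nonneg)
    have "(1 / 81) * \<kappa>\<^sup>2 * ?C \<le> t\<^sup>2 * \<kappa>\<^sup>2 * ?C"
      using t2 nn by (intro mult_right_mono) auto
    also have "\<dots> \<le> (\<kappa> + real (k - i)) * Z"
      unfolding Z[symmetric] by (rule on_cycle_mass_le) (use i s t \<kappa>0 \<kappa> kn in auto)
    also have "\<dots> \<le> (\<kappa> + x / 209952) * Z"
    proof -
      have "real (k - i) \<le> real L" using i by (simp add: k_def)
      then show ?thesis using L(1) Z0 by (intro mult_right_mono) auto
    qed
    also have "\<dots> \<le> ((1 / 81) * \<kappa>\<^sup>2 / 4) * Z"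
    proof (rule mult_right_mono)
      have "11664 * y \<le> y * y" using y by (intro mult_right_mono) auto
      then show "\<kappa> + x / 209952 \<le> (1 / 81) * \<kappa>\<^sup>2 / 4"
        unfolding \<kappa>_def yy[symmetric] by (simp add: power2_eq_square)
    qed (use Z0 in simp)
    finally have "((1 / 81) * \<kappa>\<^sup>2) * ?C \<le> ((1 / 81) * \<kappa>\<^sup>2) * (Z / 4)" by simp
    then show ?thesis using \<kappa>0 by (simp del: times_divide_eq_left times_divide_eq_right)
  qed
  have pair: "Z / 4 \<le> wsum n \<beta> (\<lambda>\<sigma>. of_bool (v \<in> cycle_of s \<sigma>))" if v: "v \<in> {s<..k}" for v
  proof -
    have "Z - Z / 4 - Z / 4 \<le> mass t n k (\<lambda>_. 1) - mass t n k (\<lambda>p. of_bool (on_cycle s p)) - mass t n k (\<lambda>p. of_bool (on_cycle v p))"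
      using on_cycle_le[of s] on_cycle_le[of v] v mass_one[OF kn, of t] Z by simp
    also have "\<dots> \<le> 2 * mass t n n (\<lambda>p. of_bool (linked s v p))"
      by (rule mass_linked_ge) (use s v t kn in auto)
    also have "mass t n n (\<lambda>p. of_bool (linked s v p)) = wsum n \<beta> (\<lambda>\<sigma>. of_bool (linked s v (graph n \<sigma>)))"
      unfolding t_def by (rule mass_top)
    also have "\<dots> \<le> wsum n \<beta> (\<lambda>\<sigma>. of_bool (v \<in> cycle_of s \<sigma>))"
      using linked_graph[OF _ s, of _ v] v kn by (intro wsum_mono) auto
    finally show ?thesis by simp
  qed
  have "x / 1679616 * Z \<le> real L * (Z / 4)"
  proof -
    have "x / 419904 \<le> real L" using L(2) large by simp
    then have "x / 419904 * (Z / 4) \<le> real L * (Z / 4)" using Z0 by (intro mult_right_mono) auto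
    then show ?thesis by simp
  qed
  also have "\<dots> = (\<Sum>v\<in>{s<..k}. Z / 4)" by (simp add: k_def)
  also have "\<dots> \<le> (\<Sum>v\<in>{s<..k}. wsum n \<beta> (\<lambda>\<sigma>. of_bool (v \<in> cycle_of s \<sigma>)))"
    by (rule sum_mono) (rule pair)
  also have "\<dots> \<le> (\<Sum>v\<in>{s<..n}. wsum n \<beta> (\<lambda>\<sigma>. of_bool (v \<in> cycle_of s \<sigma>)))"
    by (rule sum_mono2) (use kn in \<open>auto simp: wsum_def intro: sum_nonneg\<close>)
  also have "\<dots> = wsum n \<beta> (\<lambda>\<sigma>. real (card (later_points s \<sigma>)))"
    unfolding wsum_sum[symmetric] by (rule wsum_cong) (rule card_later_points[OF _ s, symmetric])
  finally show ?thesis by (simp add: Z_def)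
qed

text \<open>
  If the minimum is below \<open>11664\<^sup>2\<close>, the lower bound is trivial because every cycle has a point.
  Otherwise \<open>\<beta> < 1\<close>, and one of \<open>s\<close> and its mirror image lies in the left half.
  In the upper bound, \<open>197 = 2 * 98 + 1\<close> counts the two sides of \<open>s\<close> and \<open>s\<close> itself.
\<close>

theorem theorem1p1:
  shows "\<exists>c C :: real. c > 0 \<and> C > 0 \<and>
    (\<forall>(n::nat) (\<beta>::real) (s::nat). n \<ge> 1 \<longrightarrow> \<beta> > 0 \<longrightarrow> s \<in> {1..n} \<longrightarrow>
      c * min (max (1 / \<beta>\<^sup>2) 1) (real n)
        \<le> measure_pmf.expectation (mallows_pmf n \<beta>) (\<lambda>\<sigma>. real (card (cycle_of s \<sigma>))) \<and>
      measure_pmf.expectation (mallows_pmf n \<beta>) (\<lambda>\<sigma>. real (card (cycle_of s \<sigma>)))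
        \<le> C * min (max (1 / \<beta>\<^sup>2) 1) (real n))"
proof (rule exI[of _ "1 / 11664\<^sup>2"], rule exI[of _ 197], intro conjI allI impI)
  fix n s :: nat and \<beta> :: real
  assume \<beta>: "\<beta> > 0" and s: "s \<in> {1..n}"
  let ?E = "measure_pmf.expectation (mallows_pmf n \<beta>) (\<lambda>\<sigma>. real (card (cycle_of s \<sigma>)))"
  let ?T = "\<lambda>s. wsum n \<beta> (\<lambda>\<sigma>. real (card (later_points s \<sigma>)))"
  let ?B = "max (1 / \<beta>\<^sup>2) 1"
  define Z where "Z = mallows_Z n \<beta>"
  have Z0: "0 < Z" by (simp add: Z_def mallows_Z_pos)
  have E: "?E = (?T s + Z + ?T (flip n s)) / Z"
    unfolding expectation_wsum wsum_card_cycle_of[OF s] Z_def ..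
  have T0: "0 \<le> ?T i" for i unfolding wsum_def by (intro sum_nonneg) auto
  show "1 / 11664\<^sup>2 * min ?B (real n) \<le> ?E"
  proof (cases "min ?B (real n) \<le> 11664\<^sup>2")
    case True
    have "1 \<le> ?E" unfolding E using T0[of s] T0[of "flip n s"] Z0 by (simp add: field_simps)
    then show ?thesis using True by simp
  next
    case False
    define x where "x = min (1 / \<beta>\<^sup>2) (real n)"
    have x: "min ?B (real n) = x" "11664\<^sup>2 \<le> x"
      using False by (auto simp: x_def min_def max_def split: if_splits)
    have "x / 1679616 * Z \<le> ?T s + ?T (flip n s)"
    proof (cases "2 * s \<le> n + 1")
      case True
      then show ?thesis
        using wsum_later_points_ge[OF \<beta> s True x_def x(2)] T0[of "flip n s"] by (simp add: Z_def)
    next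
      case False
      then have "2 * flip n s \<le> n + 1" using s by (simp add: flip_def)
      then show ?thesis
        using wsum_later_points_ge[OF \<beta> flip_in[OF s] _ x_def x(2)] T0[of s] by (simp add: Z_def)
    qed
    then have "x / 1679616 * Z \<le> ?T s + Z + ?T (flip n s)" using Z0 by linarith
    then have "x / 1679616 \<le> ?E" unfolding E using Z0 by (simp add: pos_le_divide_eq)
    moreover have "1 / 11664\<^sup>2 * x \<le> x / 1679616" using x(2) by simp
    ultimately show ?thesis unfolding x(1) by linarith
  qed
  show "?E \<le> 197 * min ?B (real n)"
  proof -
    have "?E \<le> real n"
    proof -
      have "wsum n \<beta> (\<lambda>\<sigma>. real (card (cycle_of s \<sigma>))) \<le> wsum n \<beta> (\<lambda>\<sigma>. real n)"
        by (rule wsum_mono)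
           (use permutes_orbit_subset[OF _ s] card_mono[of "{1..n}"] in \<open>force simp: cycle_of_def\<close>)
      also have "\<dots> = real n * Z" by (simp add: Z_def mallows_Z_def wsum_def sum_distrib_left)
      finally show ?thesis unfolding expectation_wsum using Z0 by (simp add: Z_def pos_divide_le_eq)
    qed
    moreover have "?E \<le> 197 * ?B"
    proof -
      have "1 * Z \<le> ?B * Z" using Z0 by (intro mult_right_mono) auto
      then have "?T s + Z + ?T (flip n s) \<le> 197 * ?B * Z"
        using wsum_later_points_le[OF s \<beta>] wsum_later_points_le[OF flip_in[OF s] \<beta>]
        unfolding Z_def[symmetric] by linarith
      then show ?thesis unfolding E using Z0 by (simp add: pos_divide_le_eq)
    qed
    ultimately show ?thesis by simp
  qed
qed simp_all

end
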